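(* Let $\mathscr M$ be a type $II_1$ factor with unique faithful normal tracial state $\tau$. Then: (i) the measure topology on $\mathscr M$ is coarser than the norm topology; (ii) the measure topology on $\mathscr M$ is neither coarser nor finer than the ultraweak topology on $\mathscr M$; (iii) $\tau$ is not continuous in the measure topology; (iv) the restriction of $\tau$ to the unit ball of $\mathscr M$ is continuous in the measure topology; (v) the unit ball of $\mathscr M$ is not compact in the measure topology; (vi) the unit ball of $\mathscr M$ is complete in the measure topology.
   Context: For $\varepsilon,\delta>0$, $\mathcal O_\tau(\varepsilon,\delta)$ is the set of $A\in\mathscr M$ for which some projection $E\in\mathscr M$ satisfies $\|AE\|\le\varepsilon$ and $\tau(I-E)\le\delta$; the measure topology is the translation-invariant topology on $\mathscr M$ with these sets as a fundamental system of neighborhoods of $0$. Completeness of the unit ball means every net in the unit ball that is Cauchy in the measure topology converges in the measure topology to an element of the unit ball. *)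

theory Defs
  imports "HOL-Analysis.Analysis"
begin

class complex_hilbert = ab_group_add +
  fixes scaleC :: "complex \<Rightarrow> 'a \<Rightarrow> 'a" (infixr \<open>*\<^sub>C\<close> 75)
    and cinner :: "'a \<Rightarrow> 'a \<Rightarrow> complex"
  assumes scaleC_add_right: "a *\<^sub>C (x + y) = a *\<^sub>C x + a *\<^sub>C y"
    and scaleC_add_left: "(a + b) *\<^sub>C x = a *\<^sub>C x + b *\<^sub>C x"
    and scaleC_scaleC: "a *\<^sub>C (b *\<^sub>C x) = (a * b) *\<^sub>C x"
    and scaleC_one: "1 *\<^sub>C x = x"
    and cinner_conj: "cinner x y = cnj (cinner y x)"
    and cinner_add_right: "cinner x (y + z) = cinner x y + cinner x z"
    and cinner_scaleC_right: "cinner x (a *\<^sub>C y) = a * cinner x y"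
    and cinner_nonneg: "0 \<le> Re (cinner x x)"
    and cinner_eq_zero: "cinner x x = 0 \<Longrightarrow> x = 0"
    and hilbert_complete:
      "(\<forall>e>0. \<exists>N. \<forall>m\<ge>N. \<forall>n\<ge>N. sqrt (Re (cinner (X m - X n) (X m - X n))) < e)
       \<Longrightarrow> \<exists>L. (\<lambda>n. sqrt (Re (cinner (X n - L) (X n - L)))) \<longlonglongrightarrow> 0"

definition hnorm :: "'a::complex_hilbert \<Rightarrow> real" where
  "hnorm x = sqrt (Re (cinner x x))"

type_synonym 'a op = "'a \<Rightarrow> 'a"

definition bounded_op :: "'a::complex_hilbert op \<Rightarrow> bool" where
  "bounded_op T \<longleftrightarrow> (\<forall>x y. T (x + y) = T x + T y) \<and> (\<forall>c x. T (c *\<^sub>C x) = c *\<^sub>C T x)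
     \<and> (\<exists>K. \<forall>x. hnorm (T x) \<le> K * hnorm x)"

definition opnorm :: "'a::complex_hilbert op \<Rightarrow> real" where
  "opnorm T = Sup {hnorm (T x) | x. hnorm x \<le> 1}"

definition adj :: "'a::complex_hilbert op \<Rightarrow> 'a op" where
  "adj T = (THE S. \<forall>x y. cinner (T x) y = cinner x (S y))"

definition op_zero :: "'a::complex_hilbert op" where "op_zero = (\<lambda>x. 0)"
definition op_add :: "'a::complex_hilbert op \<Rightarrow> 'a op \<Rightarrow> 'a op" where
  "op_add A B = (\<lambda>x. A x + B x)"
definition op_diff :: "'a::complex_hilbert op \<Rightarrow> 'a op \<Rightarrow> 'a op" where
  "op_diff A B = (\<lambda>x. A x - B x)"
definition op_scale :: "complex \<Rightarrow> 'a::complex_hilbert op \<Rightarrow> 'a op" where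
  "op_scale c A = (\<lambda>x. c *\<^sub>C A x)"

definition commutant :: "'a::complex_hilbert op set \<Rightarrow> 'a op set" where
  "commutant S = {T. bounded_op T \<and> (\<forall>A\<in>S. T \<circ> A = A \<circ> T)}"

definition von_neumann_algebra :: "'a::complex_hilbert op set \<Rightarrow> bool" where
  "von_neumann_algebra M \<longleftrightarrow> M \<subseteq> {T. bounded_op T} \<and> id \<in> M
     \<and> (\<forall>A\<in>M. \<forall>B\<in>M. op_add A B \<in> M \<and> A \<circ> B \<in> M)
     \<and> (\<forall>c. \<forall>A\<in>M. op_scale c A \<in> M) \<and> (\<forall>A\<in>M. adj A \<in> M)
     \<and> commutant (commutant M) = M"

definition factor :: "'a::complex_hilbert op set \<Rightarrow> bool" where
  "factor M \<longleftrightarrow> von_neumann_algebra M \<and> M \<inter> commutant M = {op_scale c id | c. True}"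

definition projection_in :: "'a::complex_hilbert op set \<Rightarrow> 'a op \<Rightarrow> bool" where
  "projection_in M E \<longleftrightarrow> E \<in> M \<and> E \<circ> E = E \<and> adj E = E"

definition mvn_equiv :: "'a::complex_hilbert op set \<Rightarrow> 'a op \<Rightarrow> 'a op \<Rightarrow> bool" where
  "mvn_equiv M E F \<longleftrightarrow> (\<exists>V\<in>M. adj V \<circ> V = E \<and> V \<circ> adj V = F)"

text \<open>For projections, F \<le> E means E F = F.\<close>
definition finite_projection :: "'a::complex_hilbert op set \<Rightarrow> 'a op \<Rightarrow> bool" where
  "finite_projection M E \<longleftrightarrow> projection_in M E \<and>
     (\<forall>F. projection_in M F \<and> E \<circ> F = F \<and> mvn_equiv M E F \<longrightarrow> F = E)"

definition type_II1_factor :: "'a::complex_hilbert op set \<Rightarrow> bool" where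
  "type_II1_factor M \<longleftrightarrow> factor M \<and> id \<noteq> (op_zero :: 'a op) \<and> finite_projection M id
     \<and> (\<forall>E. projection_in M E \<and> E \<noteq> op_zero \<longrightarrow>
            (\<exists>F. projection_in M F \<and> F \<noteq> op_zero \<and> F \<noteq> E \<and> E \<circ> F = F))"

definition ultraweak_functionals :: "('a::complex_hilbert op \<Rightarrow> complex) set" where
  "ultraweak_functionals = {(\<lambda>A. \<Sum>n. cinner (y n) (A (x n))) | x y.
      summable (\<lambda>n. (hnorm (x n))\<^sup>2) \<and> summable (\<lambda>n. (hnorm (y n))\<^sup>2)}"

definition ultraweak_top :: "'a::complex_hilbert op set \<Rightarrow> 'a op topology" where
  "ultraweak_top M = topology_generated_by
     ({M} \<union> {{A\<in>M. \<omega> A \<in> V} | \<omega> V. \<omega> \<in> ultraweak_functionals \<and> open V})"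

definition norm_top :: "'a::complex_hilbert op set \<Rightarrow> 'a op topology" where
  "norm_top M = topology_generated_by
     {U. U \<subseteq> M \<and> (\<forall>A\<in>U. \<exists>r>0. {B\<in>M. opnorm (op_diff B A) < r} \<subseteq> U)}"

definition O_tau :: "'a::complex_hilbert op set \<Rightarrow> ('a op \<Rightarrow> complex) \<Rightarrow> real \<Rightarrow> real \<Rightarrow> 'a op set" where
  "O_tau M \<tau> \<epsilon> \<delta> = {A\<in>M. \<exists>E. projection_in M E \<and> opnorm (A \<circ> E) \<le> \<epsilon>
                                  \<and> Re (\<tau> (op_diff id E)) \<le> \<delta>}"

text \<open>Measure topology: translation-invariant topology with the O_tau(eps,delta) as a
  fundamental system of neighbourhoods of 0.\<close>
definition measure_top :: "'a::complex_hilbert op set \<Rightarrow> ('a op \<Rightarrow> complex) \<Rightarrow> 'a op topology" where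
  "measure_top M \<tau> = topology_generated_by
     {U. U \<subseteq> M \<and> (\<forall>A\<in>U. \<exists>\<epsilon>>0. \<exists>\<delta>>0. {B\<in>M. op_diff B A \<in> O_tau M \<tau> \<epsilon> \<delta>} \<subseteq> U)}"

definition faithful_normal_tracial_state ::
  "'a::complex_hilbert op set \<Rightarrow> ('a op \<Rightarrow> complex) \<Rightarrow> bool" where
  "faithful_normal_tracial_state M \<tau> \<longleftrightarrow>
     (\<forall>A\<in>M. \<forall>B\<in>M. \<tau> (op_add A B) = \<tau> A + \<tau> B \<and> \<tau> (A \<circ> B) = \<tau> (B \<circ> A))
     \<and> (\<forall>c. \<forall>A\<in>M. \<tau> (op_scale c A) = c * \<tau> A)
     \<and> (\<forall>A\<in>M. Im (\<tau> (adj A \<circ> A)) = 0 \<and> 0 \<le> Re (\<tau> (adj A \<circ> A)))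
     \<and> \<tau> id = 1
     \<and> (\<forall>A\<in>M. \<tau> (adj A \<circ> A) = 0 \<longrightarrow> A = op_zero)
     \<and> continuous_map (ultraweak_top M) euclidean \<tau>"

definition directed_set :: "'i set \<Rightarrow> ('i \<Rightarrow> 'i \<Rightarrow> bool) \<Rightarrow> bool" where
  "directed_set D le \<longleftrightarrow> D \<noteq> {} \<and> (\<forall>i\<in>D. le i i)
     \<and> (\<forall>i\<in>D. \<forall>j\<in>D. \<forall>k\<in>D. le i j \<and> le j k \<longrightarrow> le i k)
     \<and> (\<forall>i\<in>D. \<forall>j\<in>D. \<exists>k\<in>D. le i k \<and> le j k)"

definition measure_cauchy_net ::
  "'a::complex_hilbert op set \<Rightarrow> ('a op \<Rightarrow> complex) \<Rightarrow> 'i set \<Rightarrow> ('i \<Rightarrow> 'i \<Rightarrow> bool) \<Rightarrow> ('i \<Rightarrow> 'a op) \<Rightarrow> bool" where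
  "measure_cauchy_net M \<tau> D le f \<longleftrightarrow> (\<forall>\<epsilon>>0. \<forall>\<delta>>0. \<exists>i0\<in>D. \<forall>i\<in>D. \<forall>j\<in>D.
      le i0 i \<and> le i0 j \<longrightarrow> op_diff (f i) (f j) \<in> O_tau M \<tau> \<epsilon> \<delta>)"

definition net_converges_in :: "'b topology \<Rightarrow> 'i set \<Rightarrow> ('i \<Rightarrow> 'i \<Rightarrow> bool) \<Rightarrow> ('i \<Rightarrow> 'b) \<Rightarrow> 'b \<Rightarrow> bool" where
  "net_converges_in T D le f L \<longleftrightarrow> L \<in> topspace T \<and>
     (\<forall>U. openin T U \<and> L \<in> U \<longrightarrow> (\<exists>i0\<in>D. \<forall>i\<in>D. le i0 i \<longrightarrow> f i \<in> U))"

definition unit_ball :: "'a::complex_hilbert op set \<Rightarrow> 'a op set" where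
  "unit_ball M = {A\<in>M. opnorm A \<le> 1}"

end

theory Submission
  imports Defs
begin

text \<open>
  Everything rests on one inequality for projections of a finite trace,
  \<open>\<tau>(1 - E \<and> F) \<le> \<tau>(1 - E) + \<tau>(1 - F)\<close>, which makes the sets \<open>O\<^sub>\<tau>(\<epsilon>, \<delta>)\<close> additive. It needs no polar
  decomposition: \<open>E \<and> F\<close> is the strong limit of \<open>(EFE)\<^sup>n\<close>, and traciality applied to \<open>A = E(1 - F)\<close> gives
  \<open>\<tau>(E) - \<tau>((EFE)\<^sup>n) = \<tau>(F') - \<tau>((F'E'F')\<^sup>n) \<le> \<tau>(F')\<close>, where \<open>E' = 1 - E\<close>, \<open>F' = 1 - F\<close>.

  Projections of small trace, rescaled to trace 1, show that \<open>\<tau>\<close> is discontinuous; on the unit ball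
  the Cauchy-Schwarz inequality controls \<open>\<tau>\<close> on the small exceptional projection. Halving projections
  repeatedly produces Rademacher unitaries whose pairwise differences avoid a fixed \<open>O\<^sub>\<tau>(\<epsilon>, \<delta>)\<close>: hence
  the unit ball is not compact, and since finitely many ultraweak functionals nearly agree on
  two of these unitaries, \<open>O\<^sub>\<tau>(\<epsilon>, \<delta>)\<close> is no ultraweak neighbourhood of 0. For completeness, a fast Cauchy
  sequence converges uniformly on the ranges of projections increasing to 1, hence strongly.
\<close>

section \<open>Hilbert space operators as a normed algebra\<close>

text \<open>The definition of \<open>measure_top\<close> only declares which sets are open. That a
  translate of \<open>O_tau M \<tau> \<epsilon> \<delta>\<close> is a neighbourhood of its centre is
  a theorem (\<open>nb_contains_open\<close>), and additivity is what proves it: a point of the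
  interior keeps room of half the size. This is why the inequality for meets comes before everything
  topological.

  No spectral theory is developed. Projections arise as strong limits of sequences, and normality is
  used in one form: \<tau> converges along norm-bounded, strongly convergent sequences, by dominated
  convergence for the series defining ultraweak functionals. Even the norm bound for \<tau> is drawn
  from this, so its constant \<open>K\<close> is anonymous and every later \<epsilon> and \<delta>
  is tuned to it.

  Nets occur only in (vi). The sets with \<epsilon> = \<delta> = 2^-n are cofinal among the
  neighbourhoods of 0, so a Cauchy net contains an increasing sequence of indices whose limit is the
  limit of the net. The half of (ii) not covered by the Rademacher unitaries follows from (iii),
  since \<tau> is ultraweakly continuous.\<close>

lemma riesz_representation:
  fixes f :: "'b::{real_inner,complete_space} \<Rightarrow> real"
  assumes "bounded_linear f"
  shows "\<exists>v. \<forall>x. f x = inner v x"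
proof -
  interpret f: bounded_linear f by fact
  \<comment> \<open>If \<open>v\<close> represents \<open>f\<close>, then \<open>J x\<close> is |x -
    v|^2 - |v|^2; the representing vector is therefore sought as the minimiser of
    \<open>J\<close>.\<close>
  define J where "J x = inner x x - 2 * f x" for x
  obtain K where K: "\<And>x. \<bar>f x\<bar> \<le> norm x * K"
    using f.bounded by auto
  have J_lower: "- K\<^sup>2 \<le> J x" for x
  proof -
    have "f x \<le> norm x * K" using K[of x] by simp
    moreover have "0 \<le> (norm x - K)\<^sup>2" by simp
    ultimately show ?thesis
      unfolding J_def power2_norm_eq_inner[symmetric] by (simp add: power2_diff)
  qed
  define m where "m = Inf (range J)"
  have bdd: "bdd_below (range J)" using J_lower by (auto intro!: bdd_belowI[of _ "- K\<^sup>2"])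
  have m_le: "m \<le> J x" for x
    unfolding m_def by (rule cInf_lower[OF _ bdd]) simp
  have "\<exists>x. J x < m + inverse (Suc n)" for n
    using cInf_lessD[of "range J" "m + inverse (Suc n)"] unfolding m_def by auto
  then obtain X where X: "\<And>n. J (X n) < m + inverse (Suc n)" by metis
  \<comment> \<open>The linear parts cancel, leaving the parallelogram law. As \<open>J\<close> is
    at least \<open>m\<close> at the midpoint, two near-minimisers must be close.\<close>
  have parallelogram: "(norm (x - y))\<^sup>2 = 2 * J x + 2 * J y - 4 * J ((1/2) *\<^sub>R (x + y))" for x y
    unfolding J_def power2_norm_eq_inner
    by (simp add: f.scaleR f.add algebra_simps inner_commute)
  have near: "(norm (x - y))\<^sup>2 \<le> 2 * (J x - m) + 2 * (J y - m)" for x y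
    using m_le[of "(1/2) *\<^sub>R (x + y)"] unfolding parallelogram by simp
  have "Cauchy X"
  proof (rule CauchyI)
    fix e :: real assume e: "0 < e"
    then obtain n0 where n0: "inverse (Suc n0) < e\<^sup>2 / 4"
      using reals_Archimedean[of "e\<^sup>2 / 4"] by auto
    show "\<exists>n0. \<forall>m\<ge>n0. \<forall>n\<ge>n0. norm (X m - X n) < e"
    proof (intro exI allI impI)
      fix i j assume "n0 \<le> i" "n0 \<le> j"
      then have le: "inverse (Suc i) \<le> inverse (Suc n0)" "inverse (Suc j) \<le> inverse (Suc n0)"
        by (auto intro!: le_imp_inverse_le)
      have "J (X i) - m < e\<^sup>2 / 4" "J (X j) - m < e\<^sup>2 / 4"
        using le X[of i] X[of j] n0 by (smt (verit))+
      then have "2 * (J (X i) - m) + 2 * (J (X j) - m) < e\<^sup>2" by argo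
      then have "(norm (X i - X j))\<^sup>2 < e\<^sup>2"
        by (rule order.strict_trans1[OF near])
      then show "norm (X i - X j) < e"
        using e by (simp add: power2_less_imp_less)
    qed
  qed
  then obtain v where v: "X \<longlonglongrightarrow> v" by (auto simp: Cauchy_convergent_iff convergent_def)
  have "(\<lambda>n. J (X n)) \<longlonglongrightarrow> J v"
    unfolding J_def by (intro tendsto_diff tendsto_mult tendsto_const tendsto_inner v f.tendsto)
  moreover have "(\<lambda>n. m + inverse (Suc n)) \<longlonglongrightarrow> m"
    using tendsto_add[OF tendsto_const LIMSEQ_inverse_real_of_nat, of m] by simp
  ultimately have "J v \<le> m"
    by (rule LIMSEQ_le) (use X less_imp_le in blast)
  have v_min: "J v \<le> J x" for x
    using \<open>J v \<le> m\<close> m_le[of x] by simp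
  have "f x = inner v x" for x
  proof (rule ccontr)
    assume "f x \<noteq> inner v x"
    define d where "d = f x - inner v x"
    have d: "d\<^sup>2 > 0" using \<open>f x \<noteq> inner v x\<close> by (simp add: d_def)
    \<comment> \<open>A move from \<open>v\<close> by s d x changes \<open>J\<close> by -2 s d^2 +
      s^2 d^2 |x|^2, which is negative once s |x|^2 < 2. The summand 1 in the denominator covers x =
      0.\<close>
    define s where "s = 1 / (inner x x + 1)"
    have s: "s > 0" "s * inner x x < 1"
      using inner_ge_zero[of x] by (auto simp: s_def field_simps add_pos_nonneg)
    have "J (v + (s * d) *\<^sub>R x) = J v - 2 * s * d\<^sup>2 + s\<^sup>2 * d\<^sup>2 * inner x x"
      unfolding J_def d_def
      by (simp add: f.add f.diff f.scaleR algebra_simps power2_eq_square inner_commute)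
    then have "2 * s * d\<^sup>2 \<le> s\<^sup>2 * d\<^sup>2 * inner x x" using v_min[of "v + (s * d) *\<^sub>R x"] by linarith
    then have "(s * d\<^sup>2) * 2 \<le> (s * d\<^sup>2) * (s * inner x x)"
      by (simp add: algebra_simps power2_eq_square)
    then have "2 \<le> s * inner x x" using s d by (simp add: mult_le_cancel_left_pos)
    then show False using s by simp
  qed
  then show ?thesis by blast
qed

text \<open>The class \<^class>\<open>complex_hilbert\<close> has no norm or topology attached; the copy below carries the
  real inner product structure, so that the library's limits apply to vectors.\<close>
typedef ('a::complex_hilbert) hvec = "UNIV :: 'a set"
  morphisms raw Hvec by simp

setup_lifting type_definition_hvec

lemma scaleC_zero_right: "a *\<^sub>C (0::'a::complex_hilbert) = 0"
  using scaleC_add_right[of a "0::'a" 0] by simp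

lemma scaleC_zero_left: "0 *\<^sub>C (x::'a::complex_hilbert) = 0"
  using scaleC_add_left[of 0 0 x] by simp

lemma scaleC_minus_one: "(-1) *\<^sub>C (x::'a::complex_hilbert) = - x"
  using scaleC_add_left[of "-1" 1 x]
  by (simp add: scaleC_one scaleC_zero_left eq_neg_iff_add_eq_0)

lemma cinner_add_left: "cinner (x + y) z = cinner x z + cinner y (z::'a::complex_hilbert)"
  unfolding cinner_conj[of _ z] by (simp add: cinner_add_right)

lemma cinner_scaleC_left: "cinner (a *\<^sub>C x) z = cnj a * cinner x (z::'a::complex_hilbert)"
  unfolding cinner_conj[of _ z] by (simp add: cinner_scaleC_right)

lemma Im_cinner_self: "Im (cinner x (x::'a::complex_hilbert)) = 0"
  using cinner_conj[of x x] by (simp add: complex_eq_iff)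

lemma cinner_zero_right: "cinner x (0::'a::complex_hilbert) = 0"
  using cinner_add_right[of x 0 0] by simp

section \<open>Vectors as a complete real inner product space\<close>

instantiation hvec :: (complex_hilbert) real_vector
begin

lift_definition zero_hvec :: "'a hvec" is 0 .
lift_definition plus_hvec :: "'a hvec \<Rightarrow> 'a hvec \<Rightarrow> 'a hvec" is "(+)" .
lift_definition minus_hvec :: "'a hvec \<Rightarrow> 'a hvec \<Rightarrow> 'a hvec" is "(-)" .
lift_definition uminus_hvec :: "'a hvec \<Rightarrow> 'a hvec" is "uminus" .
lift_definition scaleR_hvec :: "real \<Rightarrow> 'a hvec \<Rightarrow> 'a hvec" is "\<lambda>r x. complex_of_real r *\<^sub>C x" .

instance
proof
  fix x y z :: "'a hvec" and a b :: real
  show "x + y + z = x + (y + z)" by transfer (simp add: add.assoc)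
  show "x + y = y + x" by transfer (simp add: add.commute)
  show "0 + x = x" by transfer simp
  show "- x + x = 0" by transfer simp
  show "x - y = x + - y" by transfer simp
  show "a *\<^sub>R (x + y) = a *\<^sub>R x + a *\<^sub>R y" by transfer (simp add: scaleC_add_right)
  show "(a + b) *\<^sub>R x = a *\<^sub>R x + b *\<^sub>R x" by transfer (simp add: scaleC_add_left)
  show "a *\<^sub>R b *\<^sub>R x = (a * b) *\<^sub>R x" by transfer (simp add: scaleC_scaleC)
  show "1 *\<^sub>R x = x" by transfer (simp add: scaleC_one)
qed

end

instantiation hvec :: (complex_hilbert) real_inner
begin

text \<open>Only the real part of \<open>cinner\<close> is kept. The imaginary part is recovered by
  multiplying the first argument by the imaginary unit, see \<open>cinner_raw\<close>.\<close>

lift_definition inner_hvec :: "'a hvec \<Rightarrow> 'a hvec \<Rightarrow> real" is "\<lambda>x y. Re (cinner x y)" .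
lift_definition norm_hvec :: "'a hvec \<Rightarrow> real" is hnorm .

definition dist_hvec :: "'a hvec \<Rightarrow> 'a hvec \<Rightarrow> real" where "dist_hvec x y = norm (x - y)"
definition sgn_hvec :: "'a hvec \<Rightarrow> 'a hvec" where "sgn_hvec x = x /\<^sub>R norm x"
definition uniformity_hvec :: "('a hvec \<times> 'a hvec) filter" where
  "uniformity_hvec = (INF e\<in>{0 <..}. principal {(x, y). dist x y < e})"
definition open_hvec :: "'a hvec set \<Rightarrow> bool" where
  "open_hvec S = (\<forall>x\<in>S. \<forall>\<^sub>F (x', y) in uniformity. x' = x \<longrightarrow> y \<in> S)"

instance
proof
  fix x y z :: "'a hvec" and r :: real and S :: "'a hvec set"
  show "dist x y = norm (x - y)" by (simp add: dist_hvec_def)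
  show "sgn x = x /\<^sub>R norm x" by (simp add: sgn_hvec_def)
  show "uniformity = (INF e\<in>{0 <..}. principal {(x, y::'a hvec). dist x y < e})"
    by (simp add: uniformity_hvec_def)
  show "open S = (\<forall>x\<in>S. \<forall>\<^sub>F (x', y) in uniformity. x' = x \<longrightarrow> y \<in> S)"
    by (simp add: open_hvec_def)
  show "inner x y = inner y x" by transfer (metis cinner_conj complex_cnj cnj.simps(1))
  show "inner (x + y) z = inner x z + inner y z" by transfer (simp add: cinner_add_left)
  show "inner (r *\<^sub>R x) y = r * inner x y" by transfer (simp add: cinner_scaleC_left)
  show "0 \<le> inner x x" by transfer (rule cinner_nonneg)
  show "inner x x = 0 \<longleftrightarrow> x = 0"
    by transfer (auto simp: cinner_zero_right complex_eq_iff Im_cinner_self intro: cinner_eq_zero)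
  show "norm x = sqrt (inner x x)" by transfer (simp add: hnorm_def)
qed

end

instance hvec :: (complex_hilbert) complete_space
proof
  fix X :: "nat \<Rightarrow> 'a hvec" assume X: "Cauchy X"
  have hn: "sqrt (Re (cinner (raw a - raw b) (raw a - raw b))) = norm (a - b)" for a b :: "'a hvec"
    by transfer (simp add: hnorm_def)
  have "\<exists>L. (\<lambda>n. sqrt (Re (cinner (raw (X n) - L) (raw (X n) - L)))) \<longlonglongrightarrow> 0"
    by (rule hilbert_complete) (use X in \<open>auto simp: hn Cauchy_iff\<close>)
  then obtain L where "(\<lambda>n. sqrt (Re (cinner (raw (X n) - L) (raw (X n) - L)))) \<longlonglongrightarrow> 0" ..
  then have "(\<lambda>n. norm (X n - Hvec L)) \<longlonglongrightarrow> 0"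
    using hn[of "X _" "Hvec L"] by (simp add: Hvec_inverse)
  then have "X \<longlonglongrightarrow> Hvec L"
    by (rule LIM_zero_cancel[OF tendsto_norm_zero_cancel])
  then show "convergent X" by (auto simp: convergent_def)
qed

lift_definition cscale :: "complex \<Rightarrow> 'a::complex_hilbert hvec \<Rightarrow> 'a hvec" is "(*\<^sub>C)" .

lemma cscale_add: "cscale c (x + y) = cscale c x + cscale c y"
  by transfer (rule scaleC_add_right)

lemma cscale_of_real: "cscale (of_real r) x = r *\<^sub>R x"
  by transfer simp

lemma cscale_cscale: "cscale a (cscale b x) = cscale (a * b) x"
  by transfer (rule scaleC_scaleC)

lemma inner_cscale_left: "inner (cscale c x) y = inner x (cscale (cnj c) y)"
  by transfer (simp add: cinner_scaleC_left cinner_scaleC_right)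

lemma norm_cscale: "norm (cscale c x) = cmod c * norm x"
proof (rule power2_eq_imp_eq)
  have "(norm (cscale c x))\<^sup>2 = inner x (cscale (of_real ((cmod c)\<^sup>2)) x)"
    by (simp add: power2_norm_eq_inner[of "cscale c x"] inner_cscale_left cscale_cscale
        complex_norm_square mult.commute del: of_real_power)
  also have "\<dots> = (cmod c * norm x)\<^sup>2"
    by (simp add: cscale_of_real power2_norm_eq_inner power_mult_distrib)
  finally show "(norm (cscale c x))\<^sup>2 = (cmod c * norm x)\<^sup>2" .
qed simp_all

section \<open>Bounded operators and the operator norm\<close>

typedef (overloaded) ('a::complex_hilbert) bop = "{T::'a op. bounded_op T}"
  morphisms fn Bop
proof
  show "(\<lambda>x. 0) \<in> {T::'a op. bounded_op T}"
    by (auto simp: bounded_op_def scaleC_zero_right hnorm_def cinner_zero_right intro!: exI[of _ 0])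
qed

setup_lifting type_definition_bop

text \<open>Operators act here on the copy \<open>hvec\<close>, which makes them bounded linear maps
  in the sense of the library and gives their values a topology.\<close>

definition app :: "'a::complex_hilbert bop \<Rightarrow> 'a hvec \<Rightarrow> 'a hvec" (infixr \<open>\<rhd>\<close> 75) where
  "A \<rhd> x = Hvec (fn A (raw x))"

lemma fn_eq_app: "fn A x = raw (A \<rhd> Hvec x)"
  by (simp add: app_def Hvec_inverse)

lemma hnorm_raw: "hnorm (raw x) = norm x"
  by transfer simp

lemma norm_Hvec: "norm (Hvec x) = hnorm x"
  by (simp add: hnorm_raw[symmetric] Hvec_inverse)

lemma bop_eqI: "(\<And>x. A \<rhd> x = B \<rhd> x) \<Longrightarrow> A = B"
  by (metis fn_eq_app fn_inject ext)

lemma app_add: "A \<rhd> (x + y) = A \<rhd> x + A \<rhd> y"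
  using fn[of A] by (simp add: app_def plus_hvec.rep_eq bounded_op_def plus_hvec_def Hvec_inverse)

lemma app_cscale: "A \<rhd> cscale c x = cscale c (A \<rhd> x)"
  using fn[of A] by (simp add: app_def cscale.rep_eq bounded_op_def cscale_def Hvec_inverse)

lemma app_scaleR: "A \<rhd> (r *\<^sub>R x) = r *\<^sub>R (A \<rhd> x)"
  using app_cscale[of A "of_real r" x] by (simp add: cscale_of_real)

lemma bounded_linear_app: "bounded_linear ((\<rhd>) A)"
proof -
  obtain K where "\<And>x. hnorm (fn A x) \<le> K * hnorm x"
    using fn[of A] by (auto simp: bounded_op_def)
  then have "norm (A \<rhd> x) \<le> norm x * K" for x
    by (metis app_def norm_Hvec hnorm_raw mult.commute)
  then show ?thesis
    by (intro bounded_linear_intro) (auto simp: app_add app_scaleR)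
qed

text \<open>Adjoints and strong limits are both found first as plain functions; this turns them into
  operators.\<close>

lemma bop_of_linear:
  assumes "\<And>x y. f (x + y) = f x + f y" "\<And>c x. f (cscale c x) = cscale c (f x)"
    and "\<And>x. norm (f x) \<le> K * norm x"
  obtains A where "\<And>x. A \<rhd> x = f x"
proof -
  have "bounded_op (\<lambda>x. raw (f (Hvec x)))"
    unfolding bounded_op_def
  proof (intro conjI allI exI)
    fix x y :: 'a and c
    show "raw (f (Hvec (x + y))) = raw (f (Hvec x)) + raw (f (Hvec y))"
      by (simp add: plus_hvec.rep_eq[symmetric] assms(1)[symmetric] raw_inject)
        (simp add: plus_hvec_def Hvec_inverse)
    show "raw (f (Hvec (c *\<^sub>C x))) = c *\<^sub>C raw (f (Hvec x))"
      by (simp add: cscale.rep_eq[symmetric] assms(2)[symmetric] raw_inject)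
        (simp add: cscale_def Hvec_inverse)
    show "hnorm (raw (f (Hvec x))) \<le> K * hnorm x"
      using assms(3)[of "Hvec x"] by (simp add: hnorm_raw norm_Hvec)
  qed
  then have "Bop (\<lambda>x. raw (f (Hvec x))) \<rhd> x = f x" for x
    by (simp add: app_def Bop_inverse raw_inverse)
  then show ?thesis by (rule that)
qed

lemma bdd_above_opnorm: "bdd_above {hnorm (fn A x) | x. hnorm x \<le> 1}"
proof -
  obtain K where K: "\<And>x. norm (A \<rhd> x) \<le> norm x * K" "K \<ge> 0"
    using bounded_linear.nonneg_bounded[OF bounded_linear_app] by blast
  have "norm (A \<rhd> Hvec x) \<le> K" if "hnorm x \<le> 1" for x
    using K(1)[of "Hvec x"] mult_right_mono[OF that K(2)] by (simp add: norm_Hvec)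
  then show ?thesis by (auto simp: fn_eq_app hnorm_raw intro!: bdd_aboveI[of _ K])
qed

lemma norm_app_le_opnorm: "norm (A \<rhd> x) \<le> opnorm (fn A) * norm x"
proof (cases "x = 0")
  case True
  then show ?thesis using bounded_linear_app[of A] by (simp add: linear_simps)
next
  case False
  define y where "y = x /\<^sub>R norm x"
  have "norm y = 1" using False by (simp add: y_def)
  then have "norm (A \<rhd> y) \<in> {hnorm (fn A x) | x. hnorm x \<le> 1}"
    by (auto simp: fn_eq_app hnorm_raw norm_Hvec raw_inverse intro!: exI[of _ "raw y"])
  then have "norm (A \<rhd> y) \<le> opnorm (fn A)"
    unfolding opnorm_def by (rule cSup_upper[OF _ bdd_above_opnorm])
  moreover have "norm (A \<rhd> x) = norm (A \<rhd> y) * norm x"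
    using False by (simp add: y_def app_scaleR)
  ultimately show ?thesis by (simp add: mult_right_mono)
qed

lemma opnorm_le:
  assumes "\<And>x. norm (A \<rhd> x) \<le> c * norm x" "0 \<le> c"
  shows "opnorm (fn A) \<le> c"
  unfolding opnorm_def
proof (rule cSup_least)
  show "{hnorm (fn A x) | x. hnorm x \<le> 1} \<noteq> {}"
    by (auto intro!: exI[of _ 0] simp: hnorm_def cinner_zero_right)
  fix r assume "r \<in> {hnorm (fn A x) | x. hnorm x \<le> 1}"
  then obtain x where x: "r = norm (A \<rhd> Hvec x)" "hnorm x \<le> 1" by (auto simp: fn_eq_app hnorm_raw)
  then show "r \<le> c"
    using assms(1)[of "Hvec x"] mult_left_mono[OF x(2) assms(2)] by (simp add: norm_Hvec)
qed

lemma opnorm_ge_0: "0 \<le> opnorm (fn A)"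
proof -
  have "hnorm (fn A 0) \<in> {hnorm (fn A x) | x. hnorm x \<le> 1}"
    by (auto intro!: exI[of _ 0] simp: hnorm_def cinner_zero_right)
  then have "hnorm (fn A 0) \<le> opnorm (fn A)"
    unfolding opnorm_def by (rule cSup_upper[OF _ bdd_above_opnorm])
  moreover have "0 \<le> hnorm (fn A 0)" by (simp add: hnorm_def cinner_nonneg)
  ultimately show ?thesis by linarith
qed

lemma Hvec_add: "Hvec (x + y) = Hvec x + Hvec y"
  by (simp add: plus_hvec_def Hvec_inverse)

lemma hnorm_triangle: "hnorm (x + y) \<le> hnorm x + hnorm y"
  using norm_triangle_ineq[of "Hvec x" "Hvec y"] by (simp add: norm_Hvec Hvec_add[symmetric])

lemma hnorm_scaleC: "hnorm (c *\<^sub>C x) = cmod c * hnorm x"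
  using norm_cscale[of c "Hvec x"] by (simp add: norm_Hvec cscale_def Hvec_inverse)

lemma bounded_op_zero: "bounded_op op_zero"
  by (auto simp: bounded_op_def op_zero_def scaleC_zero_right hnorm_def cinner_zero_right
      intro!: exI[of _ 0])

lemma bounded_op_id: "bounded_op id"
  by (auto simp: bounded_op_def intro!: exI[of _ 1])

lemma bounded_op_add:
  assumes "bounded_op A" "bounded_op B" shows "bounded_op (op_add A B)"
proof -
  obtain K L where "\<And>x. hnorm (A x) \<le> K * hnorm x" "\<And>x. hnorm (B x) \<le> L * hnorm x"
    using assms unfolding bounded_op_def by blast
  then have "\<forall>x. hnorm (A x + B x) \<le> (K + L) * hnorm x"
    using hnorm_triangle[of "A _" "B _"] by (smt (verit) distrib_right)
  then have "\<exists>K. \<forall>x. hnorm (A x + B x) \<le> K * hnorm x" ..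
  then show ?thesis
    using assms by (simp add: bounded_op_def op_add_def scaleC_add_right add_ac)
qed

lemma bounded_op_scale:
  assumes "bounded_op A" shows "bounded_op (op_scale c A)"
proof -
  obtain K where "\<And>x. hnorm (A x) \<le> K * hnorm x"
    using assms unfolding bounded_op_def by blast
  then have "\<forall>x. hnorm (c *\<^sub>C A x) \<le> (cmod c * K) * hnorm x"
    by (simp add: hnorm_scaleC mult_left_mono mult.assoc)
  then have "\<exists>K. \<forall>x. hnorm (c *\<^sub>C A x) \<le> K * hnorm x" ..
  then show ?thesis
    using assms by (simp add: bounded_op_def op_scale_def scaleC_add_right scaleC_scaleC mult.commute)
qed

lemma op_diff_eq: "op_diff A B = op_add A (op_scale (-1) B)"
  by (simp add: op_diff_def op_add_def op_scale_def scaleC_minus_one)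

lemma bounded_op_diff:
  "bounded_op A \<Longrightarrow> bounded_op B \<Longrightarrow> bounded_op (op_diff A B)"
  unfolding op_diff_eq by (intro bounded_op_add bounded_op_scale)

lemma bounded_op_comp:
  assumes "bounded_op A" "bounded_op B" shows "bounded_op (A \<circ> B)"
proof -
  have "hnorm (A (B x)) \<le> opnorm A * opnorm B * hnorm x" for x
  proof -
    have "hnorm (A (B x)) \<le> opnorm A * hnorm (B x)"
      using norm_app_le_opnorm[of "Bop A" "Hvec (B x)"] assms
      by (simp add: app_def Bop_inverse norm_Hvec Hvec_inverse)
    also have "\<dots> \<le> opnorm A * (opnorm B * hnorm x)"
      using norm_app_le_opnorm[of "Bop B" "Hvec x"] opnorm_ge_0[of "Bop A"] assms
      by (intro mult_left_mono) (simp_all add: app_def Bop_inverse norm_Hvec Hvec_inverse)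
    finally show ?thesis by (simp add: mult.assoc)
  qed
  then show ?thesis using assms by (auto simp: bounded_op_def)
qed

lift_definition bscale :: "complex \<Rightarrow> 'a::complex_hilbert bop \<Rightarrow> 'a bop" is op_scale
  by (rule bounded_op_scale)

instantiation bop :: (complex_hilbert) real_vector
begin

lift_definition zero_bop :: "'a bop" is op_zero by (rule bounded_op_zero)
lift_definition plus_bop :: "'a bop \<Rightarrow> 'a bop \<Rightarrow> 'a bop" is op_add by (rule bounded_op_add)
lift_definition minus_bop :: "'a bop \<Rightarrow> 'a bop \<Rightarrow> 'a bop" is op_diff by (rule bounded_op_diff)
lift_definition uminus_bop :: "'a bop \<Rightarrow> 'a bop" is "op_scale (-1)" by (rule bounded_op_scale)
definition scaleR_bop :: "real \<Rightarrow> 'a bop \<Rightarrow> 'a bop" where "scaleR_bop r = bscale (of_real r)"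

instance
proof
  fix x y z :: "'a bop" and a b :: real
  show "x + y + z = x + (y + z)" by transfer (simp add: op_add_def add.assoc)
  show "x + y = y + x" by transfer (simp add: op_add_def add.commute)
  show "0 + x = x" by transfer (simp add: op_add_def op_zero_def)
  show "- x + x = 0" by transfer (simp add: op_add_def op_scale_def op_zero_def scaleC_minus_one)
  show "x - y = x + - y" by transfer (rule op_diff_eq)
  show "a *\<^sub>R (x + y) = a *\<^sub>R x + a *\<^sub>R y"
    unfolding scaleR_bop_def by transfer (simp add: op_add_def op_scale_def scaleC_add_right)
  show "(a + b) *\<^sub>R x = a *\<^sub>R x + b *\<^sub>R x"
    unfolding scaleR_bop_def by transfer (simp add: op_add_def op_scale_def scaleC_add_left)
  show "a *\<^sub>R b *\<^sub>R x = (a * b) *\<^sub>R x"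
    unfolding scaleR_bop_def by transfer (simp add: op_scale_def scaleC_scaleC)
  show "1 *\<^sub>R x = x"
    unfolding scaleR_bop_def by transfer (simp add: op_scale_def scaleC_one)
qed

end

lemma app_zero_left [simp]: "0 \<rhd> x = 0"
  by (simp add: app_def zero_bop.rep_eq op_zero_def zero_hvec_def)

lemma app_zero_right [simp]: "A \<rhd> 0 = 0"
  by (rule linear_simps[OF bounded_linear_app])

lemma app_add_left: "(A + B) \<rhd> x = A \<rhd> x + B \<rhd> x"
  by (simp add: app_def plus_bop.rep_eq op_add_def Hvec_add)

lemma app_bscale: "bscale c A \<rhd> x = cscale c (A \<rhd> x)"
  by (simp add: app_def bscale.rep_eq op_scale_def cscale_def Hvec_inverse)

lemma app_scaleR_left: "(r *\<^sub>R A) \<rhd> x = r *\<^sub>R (A \<rhd> x)"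
  by (simp add: scaleR_bop_def app_bscale cscale_of_real)

lemma app_diff_left: "(A - B) \<rhd> x = A \<rhd> x - B \<rhd> x"
  by (metis add_diff_cancel_right' app_add_left diff_add_cancel)

lemma app_diff: "A \<rhd> (x - y) = A \<rhd> x - A \<rhd> y"
  by (rule linear_simps[OF bounded_linear_app])

instantiation bop :: (complex_hilbert) real_normed_vector
begin

definition norm_bop :: "'a bop \<Rightarrow> real" where "norm_bop A = opnorm (fn A)"
definition dist_bop :: "'a bop \<Rightarrow> 'a bop \<Rightarrow> real" where "dist_bop x y = norm (x - y)"
definition sgn_bop :: "'a bop \<Rightarrow> 'a bop" where "sgn_bop x = x /\<^sub>R norm x"
definition uniformity_bop :: "('a bop \<times> 'a bop) filter" where
  "uniformity_bop = (INF e\<in>{0 <..}. principal {(x, y). dist x y < e})"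
definition open_bop :: "'a bop set \<Rightarrow> bool" where
  "open_bop S = (\<forall>x\<in>S. \<forall>\<^sub>F (x', y) in uniformity. x' = x \<longrightarrow> y \<in> S)"

instance
proof
  fix A B :: "'a bop" and r :: real and S :: "'a bop set"
  have le: "norm (A \<rhd> x) \<le> norm A * norm x" for A :: "'a bop" and x
    unfolding norm_bop_def by (rule norm_app_le_opnorm)
  have ge_0: "0 \<le> norm A" for A :: "'a bop"
    unfolding norm_bop_def by (rule opnorm_ge_0)
  show "dist A B = norm (A - B)" by (simp add: dist_bop_def)
  show "sgn A = A /\<^sub>R norm A" by (simp add: sgn_bop_def)
  show "uniformity = (INF e\<in>{0 <..}. principal {(x, y::'a bop). dist x y < e})"
    by (simp add: uniformity_bop_def)
  show "open S = (\<forall>x\<in>S. \<forall>\<^sub>F (x', y) in uniformity. x' = x \<longrightarrow> y \<in> S)"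
    by (simp add: open_bop_def)
  show "norm A = 0 \<longleftrightarrow> A = 0"
  proof
    assume "norm A = 0"
    then show "A = 0" using le[of A] by (intro bop_eqI) simp
  next
    assume "A = 0"
    then have "norm A \<le> 0" unfolding norm_bop_def by (intro opnorm_le) auto
    then show "norm A = 0" using ge_0[of A] by simp
  qed
  show "norm (A + B) \<le> norm A + norm B"
    unfolding norm_bop_def[of "A + B"]
  proof (rule opnorm_le)
    fix x
    show "norm ((A + B) \<rhd> x) \<le> (norm A + norm B) * norm x"
      using norm_triangle_ineq[of "A \<rhd> x" "B \<rhd> x"] le[of A x] le[of B x]
      by (simp add: app_add_left distrib_right)
  qed (simp add: ge_0)
  have scale_le: "norm (r *\<^sub>R A) \<le> \<bar>r\<bar> * norm A" for r and A :: "'a bop"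
    unfolding norm_bop_def[of "r *\<^sub>R A"]
    by (rule opnorm_le) (use le[of A] ge_0[of A] in
        \<open>auto simp: app_scaleR_left mult.assoc intro!: mult_left_mono\<close>)
  show "norm (r *\<^sub>R A) = \<bar>r\<bar> * norm A"
  proof (cases "r = 0")
    case True
    then show ?thesis using scale_le[of r A] ge_0[of "r *\<^sub>R A"] by simp
  next
    case False
    have "norm A \<le> \<bar>1 / r\<bar> * norm (r *\<^sub>R A)"
      using scale_le[of "1 / r" "r *\<^sub>R A"] False by simp
    then have "\<bar>r\<bar> * norm A \<le> norm (r *\<^sub>R A)"
      using False by (simp add: field_simps)
    then show ?thesis using scale_le[of r A] by simp
  qed
qed

end

lemma norm_app: "norm (A \<rhd> x) \<le> norm A * norm x"
  unfolding norm_bop_def by (rule norm_app_le_opnorm)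

lemma norm_bop_le: "(\<And>x. norm (A \<rhd> x) \<le> c * norm x) \<Longrightarrow> 0 \<le> c \<Longrightarrow> norm A \<le> c"
  unfolding norm_bop_def by (rule opnorm_le)

text \<open>Not an instance of \<^class>\<open>ring_1\<close>: on the zero space \<open>0 = 1\<close>.\<close>
instantiation bop :: (complex_hilbert) "{real_normed_algebra, monoid_mult}"
begin

lift_definition one_bop :: "'a bop" is id by (rule bounded_op_id)
lift_definition times_bop :: "'a bop \<Rightarrow> 'a bop \<Rightarrow> 'a bop" is "(\<circ>)" by (rule bounded_op_comp)

instance
proof
  fix A B C :: "'a bop" and r :: real
  have app_times: "(A * B) \<rhd> x = A \<rhd> B \<rhd> x" for A B :: "'a bop" and x
    by (simp add: app_def times_bop.rep_eq Hvec_inverse)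
  show "A * B * C = A * (B * C)" by transfer (simp add: comp_assoc)
  show "1 * A = A" "A * 1 = A" by (transfer, simp)+
  show "(A + B) * C = A * C + B * C" "A * (B + C) = A * B + A * C"
    by (auto intro!: bop_eqI simp: app_times app_add_left app_add)
  show "r *\<^sub>R A * B = r *\<^sub>R (A * B)" "A * r *\<^sub>R B = r *\<^sub>R (A * B)"
    by (auto intro!: bop_eqI simp: app_times app_scaleR_left app_scaleR)
  show "norm (A * B) \<le> norm A * norm B"
  proof (rule norm_bop_le)
    fix x
    have "norm (A \<rhd> B \<rhd> x) \<le> norm A * norm (B \<rhd> x)" by (rule norm_app)
    also have "\<dots> \<le> norm A * (norm B * norm x)" by (intro mult_left_mono norm_app) simp
    finally show "norm ((A * B) \<rhd> x) \<le> norm A * norm B * norm x" by (simp add: app_times mult.assoc)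
  qed simp
qed

end

lemma app_times [simp]: "(A * B) \<rhd> x = A \<rhd> B \<rhd> x"
  by (simp add: app_def times_bop.rep_eq Hvec_inverse)

lemma app_one [simp]: "1 \<rhd> x = x"
  by (simp add: app_def one_bop.rep_eq raw_inverse)

lemma norm_bop_one_le: "norm (1::'a::complex_hilbert bop) \<le> 1"
  by (rule norm_bop_le) auto

lemma bscale_add: "bscale c (A + B) = bscale c A + bscale c B"
  by (rule bop_eqI) (simp add: app_bscale app_add_left cscale_add)

lemma bscale_mult_left: "bscale c A * B = bscale c (A * B)"
  by (rule bop_eqI) (simp add: app_bscale)

lemma bscale_mult_right: "A * bscale c B = bscale c (A * B)"
  by (rule bop_eqI) (simp add: app_bscale app_cscale)

lemma norm_bscale_le: "norm (bscale c A) \<le> cmod c * norm A"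
  by (rule norm_bop_le) (auto simp: app_bscale norm_cscale mult.assoc intro!: mult_left_mono norm_app)

section \<open>Adjoints\<close>

lemma inner_eqI:
  assumes "\<And>x. inner x u = inner x v"
  shows "u = v"
proof -
  have "inner (u - v) (u - v) = 0"
    using assms[of "u - v"] by (subst inner_diff_right) simp
  then show ?thesis by simp
qed

text \<open>Riesz applied to the real functional sending x to the real product of A x and y gives
  the value at y. Complex linearity is then regained by moving scalars across the real product with
  \<open>inner_cscale_left\<close>.\<close>

lemma adjoint_exists: "\<exists>B. \<forall>x y. inner (A \<rhd> x) y = inner x (B \<rhd> y)"
proof -
  have "\<exists>v. \<forall>x. inner (A \<rhd> x) y = inner v x" for y
    by (intro riesz_representation bounded_linear_compose[OF bounded_linear_inner_left bounded_linear_app])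
  then obtain S where S: "inner (A \<rhd> x) y = inner x (S y)" for x y
    by (metis inner_commute)
  have "norm (S y) \<le> norm A * norm y" for y
  proof -
    have "norm (S y) * norm (S y) = inner (A \<rhd> S y) y"
      by (simp add: S power2_norm_eq_inner[symmetric] power2_eq_square)
    also have "\<dots> \<le> (norm A * norm (S y)) * norm y"
      by (intro order.trans[OF norm_cauchy_schwarz] mult_right_mono norm_app) simp
    finally have "norm (S y) * norm (S y) \<le> norm (S y) * (norm A * norm y)"
      by (simp add: mult_ac)
    then show ?thesis
      by (cases "norm (S y) = 0") (auto simp: mult_le_cancel_left)
  qed
  moreover have "S (x + y) = S x + S y" for x y
    by (rule inner_eqI) (simp add: S[symmetric] inner_add_right)
  moreover have "S (cscale c y) = cscale c (S y)" for c y
  proof (rule inner_eqI)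
    fix x
    have "inner x (S (cscale c y)) = inner (A \<rhd> cscale (cnj c) x) y"
      using inner_cscale_left[of "cnj c" "A \<rhd> x" y] by (simp add: S[symmetric] app_cscale)
    also have "\<dots> = inner x (cscale c (S y))"
      by (simp add: S inner_cscale_left)
    finally show "inner x (S (cscale c y)) = inner x (cscale c (S y))" .
  qed
  ultimately obtain B where "\<And>y. B \<rhd> y = S y"
    using bop_of_linear[of S "norm A"] by blast
  then show ?thesis using S by (metis)
qed

lemma Re_cinner_raw: "Re (cinner (raw x) (raw y)) = inner x y"
  by transfer simp

lemma cinner_eqI:
  assumes "\<And>x. Re (cinner x u) = Re (cinner x v)"
  shows "u = (v::'a::complex_hilbert)"
proof -
  have "inner x (Hvec u) = inner x (Hvec v)" for x
    using assms[of "raw x"] by (simp add: Re_cinner_raw[symmetric] Hvec_inverse)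
  then have "Hvec u = Hvec v" by (rule inner_eqI)
  then show ?thesis by (simp add: Hvec_inject)
qed

text \<open>\<open>adj\<close> is defined through the complex product, whereas the adjoint was
  constructed for its real part. Replacing x by its multiple by the imaginary unit yields the
  imaginary parts.\<close>

lemma adj_fn:
  assumes "\<And>x y. inner (A \<rhd> x) y = inner x (B \<rhd> y)"
  shows "adj (fn A) = fn B"
proof -
  have Re_eq: "Re (cinner (fn A x) y) = Re (cinner x (fn B y))" for x y
    using assms[of "Hvec x" "Hvec y"]
    by (simp add: Re_cinner_raw[symmetric] fn_eq_app[symmetric] Hvec_inverse)
  have "cinner (fn A x) y = cinner x (fn B y)" for x y
  proof (rule complex_eqI)
    show "Re (cinner (fn A x) y) = Re (cinner x (fn B y))" by (rule Re_eq)
    have "fn A (\<i> *\<^sub>C x) = \<i> *\<^sub>C fn A x" using fn[of A] by (simp add: bounded_op_def)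
    then show "Im (cinner (fn A x) y) = Im (cinner x (fn B y))"
      using Re_eq[of "\<i> *\<^sub>C x" y] by (simp add: cinner_scaleC_left)
  qed
  then have B: "\<forall>x y. cinner (fn A x) y = cinner x (fn B y)" by blast
  show ?thesis unfolding adj_def
  proof (rule the_equality)
    fix S assume "\<forall>x y. cinner (fn A x) y = cinner x (S y)"
    then show "S = fn B" using B by (intro ext cinner_eqI) metis
  qed (rule B)
qed

lift_definition star :: "'a::complex_hilbert bop \<Rightarrow> 'a bop" is adj
  by (metis adj_fn adjoint_exists fn Bop_inverse mem_Collect_eq)

lemma fn_star: "fn (star A) = adj (fn A)" by (rule star.rep_eq)

lemma star_eqI: "(\<And>x y. inner (A \<rhd> x) y = inner x (B \<rhd> y)) \<Longrightarrow> star A = B"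
  using adj_fn[of A B] by (simp add: fn_star[symmetric] fn_inject)

lemma inner_app_left: "inner (A \<rhd> x) y = inner x (star A \<rhd> y)"
  using adjoint_exists[of A] star_eqI[of A] by metis

lemma inner_app_right: "inner x (A \<rhd> y) = inner (star A \<rhd> x) y"
  by (metis inner_app_left inner_commute)

lemma star_star [simp]: "star (star A) = A"
  by (rule star_eqI) (simp add: inner_app_right)

lemma star_mult [simp]: "star (A * B) = star B * star A"
  by (rule star_eqI) (simp add: inner_app_left)

lemma star_add [simp]: "star (A + B) = star A + star B"
  by (rule star_eqI) (simp add: app_add_left inner_add inner_app_left)

lemma star_diff [simp]: "star (A - B) = star A - star B"
  by (rule star_eqI) (simp add: app_diff_left inner_diff inner_app_left)

lemma star_one [simp]: "star 1 = 1"
  by (rule star_eqI) simp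

lemma star_zero [simp]: "star 0 = 0"
  by (rule star_eqI) simp

lemma star_power: "star (A ^ n) = star A ^ n"
  by (induction n) (auto simp: power_commutes)

lemma star_scaleR [simp]: "star (r *\<^sub>R A) = r *\<^sub>R star A"
  by (rule star_eqI) (simp add: app_scaleR_left inner_app_left)

lemma star_bscale [simp]: "star (bscale c A) = bscale (cnj c) (star A)"
  by (rule star_eqI) (simp add: app_bscale inner_cscale_left inner_app_left app_cscale)

lemma norm_star_le: "norm (star A) \<le> norm A"
proof (rule norm_bop_le)
  fix y
  have "norm (star A \<rhd> y) * norm (star A \<rhd> y) = inner (A \<rhd> star A \<rhd> y) y"
    by (simp add: inner_app_left power2_norm_eq_inner[symmetric] power2_eq_square)
  also have "\<dots> \<le> (norm A * norm (star A \<rhd> y)) * norm y"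
    by (intro order.trans[OF norm_cauchy_schwarz] mult_right_mono norm_app) simp
  finally have "norm (star A \<rhd> y) * norm (star A \<rhd> y) \<le> norm (star A \<rhd> y) * (norm A * norm y)"
    by (simp add: mult_ac)
  then show "norm (star A \<rhd> y) \<le> norm A * norm y"
    by (cases "norm (star A \<rhd> y) = 0") (auto simp: mult_le_cancel_left)
qed simp

section \<open>Strong limits of operator sequences\<close>

lemma strong_limit_exists:
  fixes X :: "nat \<Rightarrow> 'a::complex_hilbert bop"
  assumes "\<And>x. Cauchy (\<lambda>n. X n \<rhd> x)" and c: "\<And>n. norm (X n) \<le> c"
  obtains L where "\<And>x. (\<lambda>n. X n \<rhd> x) \<longlonglongrightarrow> L \<rhd> x" "norm L \<le> c"
proof -
  have "\<exists>y. (\<lambda>n. X n \<rhd> x) \<longlonglongrightarrow> y" for x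
    using assms(1)[of x] by (simp add: Cauchy_convergent_iff convergent_def)
  then obtain f where f: "(\<lambda>n. X n \<rhd> x) \<longlonglongrightarrow> f x" for x by metis
  have c_ge: "0 \<le> c" using c[of 0] norm_ge_zero order.trans by blast
  have f_le: "norm (f x) \<le> c * norm x" for x
  proof (rule tendsto_upperbound[OF tendsto_norm[OF f]])
    show "\<forall>\<^sub>F n in sequentially. norm (X n \<rhd> x) \<le> c * norm x"
      by (intro always_eventually allI order.trans[OF norm_app] mult_right_mono c) simp
  qed simp
  moreover have "f (x + y) = f x + f y" for x y
    using tendsto_add[OF f[of x] f[of y]] f[of "x + y"] LIMSEQ_unique by (simp add: app_add) blast
  moreover have "f (cscale c x) = cscale c (f x)" for c x
  proof -
    have "bounded_linear (cscale c :: 'a hvec \<Rightarrow> _)"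
    proof (rule bounded_linear_intro)
      show "cscale c (r *\<^sub>R x) = r *\<^sub>R cscale c x" for r and x :: "'a hvec"
        by (simp add: cscale_of_real[symmetric] cscale_cscale mult.commute)
      show "norm (cscale c x) \<le> norm x * cmod c" for x :: "'a hvec" by (simp add: norm_cscale mult.commute)
    qed (simp add: cscale_add)
    then have "(\<lambda>n. cscale c (X n \<rhd> x)) \<longlonglongrightarrow> cscale c (f x)"
      by (rule bounded_linear.tendsto) (rule f)
    then show ?thesis using f[of "cscale c x"] LIMSEQ_unique by (simp add: app_cscale) blast
  qed
  ultimately obtain L where L: "\<And>x. L \<rhd> x = f x" using bop_of_linear[of f c] by blast
  show ?thesis
    by (rule that[of L]) (auto simp: L f intro!: norm_bop_le f_le c_ge)
qed

text \<open>Serves two monotone situations, even powers of a selfadjoint contraction and increasing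
  projections; in both, \<open>g\<close> is the squared norm of the vectors themselves.\<close>

lemma Cauchy_of_square_dist:
  fixes f :: "nat \<Rightarrow> 'b::real_normed_vector" and g :: "nat \<Rightarrow> real"
  assumes "convergent g" and le: "\<And>m n. m \<le> n \<Longrightarrow> (norm (f m - f n))\<^sup>2 \<le> \<bar>g m - g n\<bar>"
  shows "Cauchy f"
proof (rule CauchyI)
  fix e :: real assume e: "0 < e"
  then have "0 < e\<^sup>2" by simp
  with \<open>convergent g\<close> obtain M where M: "\<And>m n. M \<le> m \<Longrightarrow> M \<le> n \<Longrightarrow> \<bar>g m - g n\<bar> < e\<^sup>2"
    unfolding Cauchy_convergent_iff[symmetric] Cauchy_iff real_norm_def by blast
  have small: "norm (f m - f n) < e" if "M \<le> m" "m \<le> n" for m n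
  proof -
    have "(norm (f m - f n))\<^sup>2 < e\<^sup>2"
      using M[of m n] that by (intro le_less_trans[OF le[OF \<open>m \<le> n\<close>]]) auto
    then show ?thesis using e by (simp add: power2_less_imp_less)
  qed
  show "\<exists>M. \<forall>m\<ge>M. \<forall>n\<ge>M. norm (f m - f n) < e"
    using small by (metis nle_le norm_minus_commute)
qed

lemma norm_diff_power2: "(norm (x - y))\<^sup>2 = (norm x)\<^sup>2 + (norm y)\<^sup>2 - 2 * inner x y"
  by (simp add: power2_norm_eq_inner inner_diff inner_commute)

lemma norm_app_contraction: "norm A \<le> 1 \<Longrightarrow> norm (A \<rhd> x) \<le> norm x"
  using norm_app[of A x] mult_right_mono[of "norm A" 1 "norm x"] by simp

lemma norm_power_contraction:
  fixes S :: "'a::complex_hilbert bop"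
  assumes "norm S \<le> 1" shows "norm (S ^ n) \<le> 1"
proof (induction n)
  case 0
  then show ?case by (simp add: norm_bop_one_le)
next
  case (Suc n)
  have "norm (S ^ Suc n) \<le> norm S * norm (S ^ n)" by (simp add: norm_mult_ineq)
  also have "\<dots> \<le> 1" using assms Suc by (simp add: mult_le_one)
  finally show ?case .
qed

lemma star_strong_limit:
  assumes "\<And>n. star (X n) = X n" and lim: "\<And>x. (\<lambda>n. X n \<rhd> x) \<longlonglongrightarrow> P \<rhd> x"
  shows "star P = P"
proof (rule star_eqI)
  fix x y
  have "(\<lambda>n. inner (X n \<rhd> x) y) \<longlonglongrightarrow> inner (P \<rhd> x) y"
    by (intro tendsto_inner lim tendsto_const)
  moreover have "(\<lambda>n. inner (X n \<rhd> x) y) \<longlonglongrightarrow> inner x (P \<rhd> y)"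
    by (simp only: inner_app_left assms(1)) (intro tendsto_inner lim tendsto_const)
  ultimately show "inner (P \<rhd> x) y = inner x (P \<rhd> y)" by (rule LIMSEQ_unique)
qed

text \<open>Odd powers may oscillate (S = -1), and even powers make it unnecessary to know that S is
  positive. The product of S^(2m) x and S^(2n) x is |S^(m+n) x|^2, which for m <= n is at least
  |S^(2n) x|^2; hence the squared distance is at most the drop of a decreasing, nonnegative
  sequence.\<close>

lemma selfadjoint_even_power_limit:
  fixes S :: "'a::complex_hilbert bop"
  assumes "star S = S" "norm S \<le> 1"
  obtains P where "\<And>x. (\<lambda>n. S ^ (2 * n) \<rhd> x) \<longlonglongrightarrow> P \<rhd> x"
proof -
  have inner_power: "inner (S ^ i \<rhd> x) (S ^ j \<rhd> x) = inner x (S ^ (i + j) \<rhd> x)" for i j x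
    by (simp add: inner_app_left star_power assms(1) power_add)
  have square: "inner x (S ^ (2 * k) \<rhd> x) = (norm (S ^ k \<rhd> x))\<^sup>2" for k x
    by (simp add: power2_norm_eq_inner inner_power mult_2)
  have dec: "decseq (\<lambda>k. (norm (S ^ k \<rhd> x))\<^sup>2)" for x
    by (intro decseq_SucI power_mono) (simp_all add: norm_app_contraction assms(2))
  have "Cauchy (\<lambda>n. S ^ (2 * n) \<rhd> x)" for x
  proof (rule Cauchy_of_square_dist)
    have "convergent (\<lambda>k. (norm (S ^ k \<rhd> x))\<^sup>2)"
      by (rule Bseq_monoseq_convergent)
        (use dec decseq_imp_monoseq in \<open>auto intro!: decseq_bounded[of _ 0]\<close>)
    from convergent_subseq_convergent[OF this, of "\<lambda>n. 2 * n"]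
    show "convergent (\<lambda>n. (norm (S ^ (2 * n) \<rhd> x))\<^sup>2)"
      by (simp add: strict_mono_def comp_def)
    fix m n :: nat assume "m \<le> n"
    have "inner (S ^ (2 * m) \<rhd> x) (S ^ (2 * n) \<rhd> x) = (norm (S ^ (m + n) \<rhd> x))\<^sup>2"
      using square[of x "m + n"] by (simp add: inner_power)
    moreover have "(norm (S ^ (2 * n) \<rhd> x))\<^sup>2 \<le> (norm (S ^ (m + n) \<rhd> x))\<^sup>2"
      using dec[of x] \<open>m \<le> n\<close> by (simp add: decseq_def)
    moreover have "(norm (S ^ (m + n) \<rhd> x))\<^sup>2 \<le> (norm (S ^ (2 * m) \<rhd> x))\<^sup>2"
      using dec[of x] \<open>m \<le> n\<close> by (simp add: decseq_def)
    ultimately show "(norm (S ^ (2 * m) \<rhd> x - S ^ (2 * n) \<rhd> x))\<^sup>2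
        \<le> \<bar>(norm (S ^ (2 * m) \<rhd> x))\<^sup>2 - (norm (S ^ (2 * n) \<rhd> x))\<^sup>2\<bar>"
      unfolding norm_diff_power2[of "S ^ (2 * m) \<rhd> x"] by argo
  qed
  then obtain P where "\<And>x. (\<lambda>n. S ^ (2 * n) \<rhd> x) \<longlonglongrightarrow> P \<rhd> x"
    using strong_limit_exists[of "\<lambda>n. S ^ (2 * n)" 1] norm_power_contraction[OF assms(2)] by blast
  then show ?thesis by (rule that)
qed

section \<open>Selfadjoint idempotents and corners\<close>

lemma norm_selfadjoint_idempotent:
  assumes "E * E = E" "star E = E" shows "norm E \<le> 1"
proof (rule norm_bop_le)
  fix x
  have "norm (E \<rhd> x) * norm (E \<rhd> x) = inner (E \<rhd> x) x"
    using inner_app_right[of "E \<rhd> x" E x] assms app_times[of E E x]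
    by (simp add: power2_norm_eq_inner[symmetric] power2_eq_square[symmetric])
  also have "\<dots> \<le> norm (E \<rhd> x) * norm x" by (rule norm_cauchy_schwarz)
  finally show "norm (E \<rhd> x) \<le> 1 * norm x"
    by (cases "norm (E \<rhd> x) = 0") (auto simp: mult_le_cancel_left)
qed simp

text \<open>Pythagoras: |v|^2 = |F v|^2 + |v - F v|^2.\<close>

lemma idempotent_fixes:
  assumes "F * F = F" "star F = F" "norm v \<le> norm (F \<rhd> v)"
  shows "F \<rhd> v = v"
proof -
  have "inner v (F \<rhd> v) = (norm (F \<rhd> v))\<^sup>2"
    using inner_app_right[of "F \<rhd> v" F v] assms(1,2) app_times[of F F v]
    by (simp add: power2_norm_eq_inner inner_commute)
  moreover have "(norm v)\<^sup>2 \<le> (norm (F \<rhd> v))\<^sup>2" using assms(3) by (simp add: power_mono)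
  ultimately have "(norm (v - F \<rhd> v))\<^sup>2 \<le> 0"
    unfolding norm_diff_power2 by argo
  then show ?thesis by simp
qed

text \<open>\<open>1 - Q\<close> and \<open>S\<close> act on complementary corners, so all mixed
  products vanish. The exponent must be positive: at exponent 0 the two sides are 1 and (1 - Q) +
  1.\<close>

lemma power_orthogonal_sum:
  fixes S :: "'a::complex_hilbert bop"
  assumes "Q * Q = Q" "Q * S = S" "S * Q = S"
  shows "((1 - Q) + S) ^ Suc n = (1 - Q) + S ^ Suc n"
proof (induction n)
  case (Suc n)
  have "Q * S ^ Suc n = S ^ Suc n" using assms(2) by (simp add: mult.assoc[symmetric])
  then have "(1 - Q + S) * (1 - Q + S ^ Suc n) = 1 - Q + S * S ^ Suc n"
    using assms by (simp add: algebra_simps)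
  then show ?case using Suc by (simp only: power_Suc[of _ "Suc n"])
qed simp

lemma mult_orthogonal_corners:
  fixes A B E F :: "'b::ring"
  assumes "A * E = A" "F * B = B" "E * F = 0" shows "A * B = 0"
proof -
  have "A * B = A * (E * F) * B" by (metis assms(1,2) mult.assoc)
  then show ?thesis using assms(3) by simp
qed

lemma mult_absorb_left: "F * X = X \<Longrightarrow> E * F = F \<Longrightarrow> E * X = (X::'b::semigroup_mult)"
  by (metis mult.assoc)

lemma mult_absorb_right: "X * F = X \<Longrightarrow> F * E = F \<Longrightarrow> X * E = (X::'b::semigroup_mult)"
  by (metis mult.assoc)

section \<open>Diffuse traces\<close>

text \<open>\<open>limit_mem\<close> is the sequential trace of the double commutant property,
  \<open>t_limit\<close> that of normality, and \<open>diffuse\<close> says that no projection is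
  minimal.\<close>

locale diffuse_trace =
  fixes N :: "'h::complex_hilbert bop set" and t :: "'h bop \<Rightarrow> complex"
  assumes one_mem: "1 \<in> N"
    and add_mem: "A \<in> N \<Longrightarrow> B \<in> N \<Longrightarrow> A + B \<in> N"
    and mult_mem: "A \<in> N \<Longrightarrow> B \<in> N \<Longrightarrow> A * B \<in> N"
    and bscale_mem: "A \<in> N \<Longrightarrow> bscale c A \<in> N"
    and star_mem: "A \<in> N \<Longrightarrow> star A \<in> N"
    and limit_mem: "(\<And>n::nat. X n \<in> N) \<Longrightarrow> (\<And>x. (\<lambda>n. X n \<rhd> x) \<longlonglongrightarrow> L \<rhd> x) \<Longrightarrow> L \<in> N"
    and t_add: "A \<in> N \<Longrightarrow> B \<in> N \<Longrightarrow> t (A + B) = t A + t B"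
    and t_comm: "A \<in> N \<Longrightarrow> B \<in> N \<Longrightarrow> t (A * B) = t (B * A)"
    and t_bscale: "A \<in> N \<Longrightarrow> t (bscale c A) = c * t A"
    and t_real: "A \<in> N \<Longrightarrow> Im (t (star A * A)) = 0"
    and t_pos: "A \<in> N \<Longrightarrow> 0 \<le> Re (t (star A * A))"
    and t_one: "t 1 = 1"
    and t_faithful: "A \<in> N \<Longrightarrow> t (star A * A) = 0 \<Longrightarrow> A = 0"
    and t_limit: "(\<And>n::nat. X n \<in> N) \<Longrightarrow> (\<And>n. norm (X n) \<le> b)
      \<Longrightarrow> (\<And>x. (\<lambda>n. X n \<rhd> x) \<longlonglongrightarrow> L \<rhd> x) \<Longrightarrow> (\<lambda>n. t (X n)) \<longlonglongrightarrow> t L"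
    and diffuse: "E \<in> N \<Longrightarrow> E * E = E \<Longrightarrow> star E = E \<Longrightarrow> E \<noteq> 0
      \<Longrightarrow> \<exists>F\<in>N. F * F = F \<and> star F = F \<and> F \<noteq> 0 \<and> F \<noteq> E \<and> E * F = F"
begin

lemma scaleR_mem: "A \<in> N \<Longrightarrow> r *\<^sub>R A \<in> N"
  by (simp add: scaleR_bop_def bscale_mem)

lemma zero_mem: "0 \<in> N"
  using scaleR_mem[OF one_mem, of 0] by simp

lemma uminus_mem: "A \<in> N \<Longrightarrow> - A \<in> N"
  using scaleR_mem[of A "-1"] by simp

lemma diff_mem: "A \<in> N \<Longrightarrow> B \<in> N \<Longrightarrow> A - B \<in> N"
  using add_mem[of A "- B"] uminus_mem[of B] by simp

lemma power_mem: "A \<in> N \<Longrightarrow> A ^ n \<in> N"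
  by (induction n) (auto simp: one_mem mult_mem)

lemmas mem = one_mem zero_mem add_mem diff_mem uminus_mem mult_mem scaleR_mem bscale_mem star_mem power_mem

lemma t_scaleR: "A \<in> N \<Longrightarrow> t (r *\<^sub>R A) = of_real r * t A"
  by (simp add: scaleR_bop_def t_bscale)

lemma t_zero: "t 0 = 0"
  using t_scaleR[OF one_mem, of 0] by simp

lemma t_diff: "A \<in> N \<Longrightarrow> B \<in> N \<Longrightarrow> t (A - B) = t A - t B"
  using t_add[of "A - B" B] by (simp add: mem)

text \<open>Polarisation: reality of \<open>t\<close> on the square of \<open>A + 1\<close>
  determines the imaginary part of \<open>t (star A)\<close>, and on the square of
  \<open>A + bscale \<i> 1\<close> its real part.\<close>

lemma t_star:
  assumes "A \<in> N" shows "t (star A) = cnj (t A)"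
proof (rule complex_eqI)
  have "star (A + 1) * (A + 1) = star A * A + star A + A + 1" by (simp add: algebra_simps)
  then have "t (star (A + 1) * (A + 1)) = t (star A * A) + t (star A) + t A + 1"
    by (simp add: t_add mem assms t_one)
  then show "Im (t (star A)) = Im (cnj (t A))"
    using t_real[of "A + 1"] t_real[OF assms] by (simp add: mem assms)
  have "star (A + bscale \<i> 1) * (A + bscale \<i> 1)
      = star A * A + bscale \<i> (star A) + bscale (- \<i>) A + bscale \<i> (bscale (- \<i>) 1)"
    by (simp add: distrib_left distrib_right bscale_mult_left bscale_mult_right bscale_add add_ac)
  then have "t (star (A + bscale \<i> 1) * (A + bscale \<i> 1))
      = t (star A * A) + \<i> * t (star A) + (- \<i>) * t A + 1"
    by (simp add: t_add t_bscale mem assms t_one)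
  then show "Re (t (star A)) = Re (cnj (t A))"
    using t_real[of "A + bscale \<i> 1"] t_real[OF assms] by (simp add: mem assms)
qed

section \<open>Projections and their traces\<close>

definition proj :: "'h bop \<Rightarrow> bool" where
  "proj E \<longleftrightarrow> E \<in> N \<and> E * E = E \<and> star E = E"

lemma projD: assumes "proj E" shows "E \<in> N" "E * E = E" "star E = E"
  using assms by (auto simp: proj_def)

lemma proj_one: "proj 1" by (simp add: proj_def mem)
lemma proj_zero: "proj 0" by (simp add: proj_def mem)

lemma proj_compl: "proj E \<Longrightarrow> proj (1 - E)"
  by (auto simp: proj_def mem algebra_simps)

lemma norm_proj: "proj E \<Longrightarrow> norm E \<le> 1"
  by (simp add: norm_selfadjoint_idempotent proj_def)

lemma proj_le_sym: "proj E \<Longrightarrow> proj F \<Longrightarrow> E * F = F \<Longrightarrow> F * E = F"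
  by (metis projD(3) star_mult)

lemma proj_diff:
  assumes "proj E" "proj F" "E * F = F" shows "proj (E - F)"
  using assms proj_le_sym[OF assms] by (auto simp: proj_def mem algebra_simps)

lemma t_proj_real: "proj E \<Longrightarrow> Im (t E) = 0"
  using t_real[of E] by (simp add: proj_def)

lemma t_proj_ge_0: "proj E \<Longrightarrow> 0 \<le> Re (t E)"
  using t_pos[of E] by (simp add: proj_def)

lemma t_proj_pos:
  assumes "proj E" "E \<noteq> 0" shows "0 < Re (t E)"
proof -
  have "t E \<noteq> 0" using t_faithful[of E] assms by (auto simp: proj_def)
  then show ?thesis
    using t_proj_ge_0[OF assms(1)] t_proj_real[OF assms(1)] by (auto simp: complex_eq_iff)
qed

lemma t_proj_compl: "proj E \<Longrightarrow> Re (t (1 - E)) = 1 - Re (t E)"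
  by (simp add: t_diff mem projD t_one)

section \<open>Estimates for the trace\<close>

text \<open>Otherwise rescaled witnesses of unboundedness would tend to 0 in norm, hence strongly
  and boundedly, while their traces keep modulus at least 1; this contradicts
  \<open>t_limit\<close>.\<close>

lemma t_bounded: "\<exists>K\<ge>0. \<forall>A\<in>N. cmod (t A) \<le> K * norm A"
proof (rule ccontr)
  assume no: "\<not> ?thesis"
  have "\<exists>A\<in>N. cmod (t A) > real (Suc n) * norm A" for n
    using no[simplified, rule_format, of "real (Suc n)"] by (auto simp: not_le)
  then obtain A where A: "\<And>n. A n \<in> N" "\<And>n. cmod (t (A n)) > real (Suc n) * norm (A n)"
    by metis
  have A0: "norm (A n) > 0" for n
    using A(2)[of n] by (auto simp: t_zero)
  define B where "B n = (1 / (real (Suc n) * norm (A n))) *\<^sub>R A n" for n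
  have norm_B: "norm (B n) = 1 / real (Suc n)" for n
    using A0[of n] by (simp add: B_def)
  have "B \<longlonglongrightarrow> 0"
    using LIMSEQ_inverse_real_of_nat by (intro tendsto_norm_zero_cancel[of B]) (simp add: norm_B inverse_eq_divide)
  have strong: "(\<lambda>n. B n \<rhd> x) \<longlonglongrightarrow> 0 \<rhd> x" for x
  proof (rule tendsto_norm_zero_cancel[THEN tendsto_eq_rhs])
    show "(\<lambda>n. norm (B n \<rhd> x)) \<longlonglongrightarrow> 0"
    proof (rule tendsto_sandwich[OF _ _ tendsto_const])
      show "(\<lambda>n. norm (B n) * norm x) \<longlonglongrightarrow> 0"
        using tendsto_mult_left_zero[OF tendsto_norm_zero[OF \<open>B \<longlonglongrightarrow> 0\<close>]] .
    qed (auto intro!: always_eventually norm_app)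
  qed simp
  have "(\<lambda>n. t (B n)) \<longlonglongrightarrow> t 0"
  proof (rule t_limit[OF _ _ strong])
    show "B n \<in> N" for n by (simp add: B_def mem A)
    show "norm (B n) \<le> 1" for n by (simp add: norm_B)
  qed
  then have "(\<lambda>n. cmod (t (B n))) \<longlonglongrightarrow> 0" by (simp add: t_zero tendsto_norm_zero)
  moreover have "cmod (t (B n)) \<ge> 1" for n
  proof -
    have "cmod (t (B n)) = cmod (t (A n)) / (real (Suc n) * norm (A n))"
      unfolding B_def t_scaleR[OF A(1)] norm_mult norm_of_real by simp
    then show ?thesis using A(2)[of n] A0[of n] by (simp add: le_divide_eq_1_pos)
  qed
  ultimately show False
    using LIMSEQ_le_const[of "\<lambda>n. cmod (t (B n))" 0 1] by auto
qed

text \<open>Any bound will do: the sharp value \<open>K = 1\<close> is never needed.\<close>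
definition K :: real where "K = (SOME K. 0 \<le> K \<and> (\<forall>A\<in>N. cmod (t A) \<le> K * norm A))"

lemma K_nonneg: "0 \<le> K" and t_le: "A \<in> N \<Longrightarrow> cmod (t A) \<le> K * norm A"
  using someI_ex[OF t_bounded[unfolded Bex_def]] unfolding K_def by auto

text \<open>Positivity of \<open>t\<close> on the square of \<open>s *\<^sub>R A - B\<close>. The
  free weight \<open>s\<close> does the work of Cauchy-Schwarz without square roots of
  traces.\<close>

lemma t_am_gm:
  assumes "A \<in> N" "B \<in> N"
  shows "2 * s * Re (t (star A * B)) \<le> s\<^sup>2 * Re (t (star A * A)) + Re (t (star B * B))"
proof -
  define C where "C = s *\<^sub>R A - B"
  have "star C * C = s\<^sup>2 *\<^sub>R (star A * A) - s *\<^sub>R (star A * B) - s *\<^sub>R (star B * A) + star B * B"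
    by (simp add: C_def algebra_simps power2_eq_square)
  then have "t (star C * C) = s\<^sup>2 * t (star A * A) - s * t (star A * B) - s * t (star B * A) + t (star B * B)"
    by (simp add: t_add t_diff t_scaleR mem assms)
  moreover have "t (star B * A) = cnj (t (star A * B))"
    using t_star[of "star A * B"] by (simp add: mem assms)
  moreover have "0 \<le> Re (t (star C * C))" by (rule t_pos) (simp add: C_def mem assms)
  ultimately show ?thesis by simp
qed

text \<open>Cauchy-Schwarz for \<open>star A\<close> and \<open>P\<close>. The weight sqrt \<delta>
  in \<open>t_am_gm\<close> balances the term containing the norm of A against the trace of
  P.\<close>

lemma t_mult_proj_le:
  assumes A: "A \<in> N" and P: "proj P" "Re (t P) \<le> \<delta>" and "0 < \<delta>"
  shows "cmod (t (A * P)) \<le> sqrt \<delta> * (K * (norm A)\<^sup>2 + 1)"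
proof -
  \<comment> \<open>Stated for every B no larger than A because it is applied to unimodular
    multiples of A: the factors 1, -1 and the two imaginary units turn a one-sided bound on real
    parts into a bound on the modulus.\<close>
  have Re_le: "Re (t (B * P)) \<le> sqrt \<delta> * (K * (norm A)\<^sup>2 + 1) / 2"
    if B: "B \<in> N" "norm B \<le> norm A" for B
  proof -
    have "Re (t (B * star B)) \<le> K * norm (B * star B)"
      using t_le[of "B * star B"] complex_Re_le_cmod[of "t (B * star B)"] by (simp add: mem B)
    also have "\<dots> \<le> K * (norm A)\<^sup>2"
    proof (rule mult_left_mono[OF _ K_nonneg])
      have "norm (B * star B) \<le> norm B * norm (star B)" by (rule norm_mult_ineq)
      also have "\<dots> \<le> norm A * norm A"
        using B norm_star_le[of B] by (intro mult_mono) auto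
      finally show "norm (B * star B) \<le> (norm A)\<^sup>2" by (simp add: power2_eq_square)
    qed
    finally have "\<delta> * Re (t (B * star B)) \<le> \<delta> * (K * (norm A)\<^sup>2)"
      using \<open>0 < \<delta>\<close> by simp
    moreover have "2 * sqrt \<delta> * Re (t (B * P)) \<le> \<delta> * Re (t (B * star B)) + Re (t P)"
      using t_am_gm[of "star B" P "sqrt \<delta>"] B projD[OF P(1)] \<open>0 < \<delta>\<close> by (simp add: mem)
    ultimately have "2 * sqrt \<delta> * Re (t (B * P)) \<le> \<delta> * (K * (norm A)\<^sup>2 + 1)"
      using P(2) by (simp add: algebra_simps)
    also have "\<dots> = 2 * sqrt \<delta> * (sqrt \<delta> * (K * (norm A)\<^sup>2 + 1) / 2)"
      using \<open>0 < \<delta>\<close> by (simp add: mult.assoc[symmetric])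
    finally show ?thesis
      using \<open>0 < \<delta>\<close> by (subst (asm) mult_le_cancel_left_pos) simp_all
  qed
  have c: "Re (c * t (A * P)) \<le> sqrt \<delta> * (K * (norm A)\<^sup>2 + 1) / 2" if "cmod c = 1" for c
  proof -
    have "norm (bscale c A) \<le> norm A" using norm_bscale_le[of c A] that by simp
    then have "Re (t (bscale c A * P)) \<le> sqrt \<delta> * (K * (norm A)\<^sup>2 + 1) / 2"
      by (intro Re_le bscale_mem A)
    then show ?thesis by (simp add: bscale_mult_left t_bscale mem A projD[OF P(1)])
  qed
  have "\<bar>Re (t (A * P))\<bar> \<le> sqrt \<delta> * (K * (norm A)\<^sup>2 + 1) / 2"
    using c[of 1] c[of "-1"] by simp
  moreover have "\<bar>Im (t (A * P))\<bar> \<le> sqrt \<delta> * (K * (norm A)\<^sup>2 + 1) / 2"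
    using c[of \<i>] c[of "-\<i>"] by simp
  ultimately show ?thesis using cmod_le[of "t (A * P)"] by linarith
qed

text \<open>This is \<open>O_tau\<close> on the type of bounded operators, see
  \<open>O_tau_iff\<close>.\<close>

definition meas_nbhd :: "real \<Rightarrow> real \<Rightarrow> 'h bop set" where
  "meas_nbhd \<epsilon> \<delta> = {A\<in>N. \<exists>E. proj E \<and> norm (A * E) \<le> \<epsilon> \<and> Re (t (1 - E)) \<le> \<delta>}"

text \<open>Split A into \<open>A * E\<close> and \<open>A * (1 - E)\<close>: the first part is
  small in norm, the second is controlled by the small trace of \<open>1 - E\<close>. The norm of A
  enters the second bound, so continuity of the trace results only on bounded sets.\<close>

lemma t_meas_nbhd_le:
  assumes "A \<in> meas_nbhd \<epsilon> \<delta>" "0 < \<delta>"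
  shows "cmod (t A) \<le> K * \<epsilon> + sqrt \<delta> * (K * (norm A)\<^sup>2 + 1)"
proof -
  obtain E where A: "A \<in> N" and E: "proj E" "norm (A * E) \<le> \<epsilon>" "Re (t (1 - E)) \<le> \<delta>"
    using assms(1) by (auto simp: meas_nbhd_def)
  have "A = A * E + A * (1 - E)" by (simp add: algebra_simps)
  then have "t A = t (A * E) + t (A * (1 - E))"
    using t_add[of "A * E" "A * (1 - E)"] by (simp add: mem A projD[OF E(1)])
  then have "cmod (t A) \<le> cmod (t (A * E)) + cmod (t (A * (1 - E)))"
    by (simp add: norm_triangle_ineq)
  moreover have "cmod (t (A * E)) \<le> K * \<epsilon>"
    using t_le[of "A * E"] mult_left_mono[OF E(2) K_nonneg] by (simp add: mem A projD[OF E(1)])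
  moreover have "cmod (t (A * (1 - E))) \<le> sqrt \<delta> * (K * (norm A)\<^sup>2 + 1)"
    by (rule t_mult_proj_le[OF A proj_compl[OF E(1)] E(3) assms(2)])
  ultimately show ?thesis by linarith
qed

section \<open>Traces of powers and meets of projections\<close>

text \<open>A intertwines \<open>1 - B * A\<close> with \<open>1 - A * B\<close>, so one factor can
  be split off a power and rotated by traciality. The complements are used because, for A = E (1 -
  F) and B = (1 - F) E, \<open>1 - A * B\<close> is (1 - E) + E F E.\<close>

lemma t_power_compl_swap:
  assumes "A \<in> N" "B \<in> N"
  shows "t ((1 - A * B) ^ n) = t ((1 - B * A) ^ n)"
proof (induction n)
  case (Suc n)
  have swap: "A * (1 - B * A) ^ n = (1 - A * B) ^ n * A" for n
  proof (induction n)
    case (Suc n)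
    have "A * (1 - B * A) ^ Suc n = (1 - A * B) * (A * (1 - B * A) ^ n)"
      by (simp add: algebra_simps)
    then show ?case using Suc by (simp add: mult.assoc)
  qed simp
  have "(1 - A * B) ^ Suc n = (1 - A * B) ^ n - A * ((1 - B * A) ^ n * B)"
    using swap[of n] by (simp only: power_Suc2 mult.assoc[symmetric]) (simp add: algebra_simps)
  then have "t ((1 - A * B) ^ Suc n) = t ((1 - A * B) ^ n) - t (A * ((1 - B * A) ^ n * B))"
    by (simp add: t_diff mem assms)
  also have "t (A * ((1 - B * A) ^ n * B)) = t ((1 - B * A) ^ n * B * A)"
    by (rule t_comm) (simp_all add: mem assms)
  also have "t ((1 - A * B) ^ n) - t ((1 - B * A) ^ n * B * A)
      = t ((1 - B * A) ^ n - (1 - B * A) ^ n * B * A)"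
    using Suc by (simp add: t_diff mem assms)
  also have "(1 - B * A) ^ n - (1 - B * A) ^ n * B * A = (1 - B * A) ^ Suc n"
    by (simp only: power_Suc2) (simp add: algebra_simps)
  finally show ?case .
qed simp

text \<open>For \<open>A = E (1 - F)\<close> the operators \<open>A A\<^sup>*\<close> and \<open>A\<^sup>* A\<close> have the same trace moments; this
  replaces the polar decomposition in Kaplansky's formula.\<close>
lemma t_power_sandwich_ge:
  assumes E: "proj E" and F: "proj F"
  shows "Re (t E) + Re (t F) - 1 \<le> Re (t ((E * F * E) ^ (2 * n)))"
\<comment> \<open>Exponent 0 is excluded from \<open>power_orthogonal_sum\<close>; there the claim
  only says that t E + t F - 1 is at most 1.\<close>
proof (cases n)
  case 0
  then show ?thesis
    using t_proj_ge_0[OF proj_compl[OF E]] t_proj_ge_0[OF proj_compl[OF F]]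
    by (simp add: t_proj_compl E F t_one)
next
  case (Suc k)
  define E' where "E' = 1 - E"
  define F' where "F' = 1 - F"
  have E': "proj E'" and F': "proj F'" by (simp_all add: E'_def F'_def proj_compl E F)
  note [simp] = projD[OF E] projD[OF F] projD[OF E'] projD[OF F']
  define S where "S = F' * E' * F'"
  define m where "m = Suc (2 * k)"
  have n: "2 * n = Suc m" by (simp add: m_def Suc)
  have [simp]: "E * (E * X) = E * X" "F' * (F' * X) = F' * X" for X
    by (simp_all add: mult.assoc[symmetric])
  have eq1: "1 - (E * F') * (F' * E) = (1 - E) + E * F * E"
    by (simp add: mult.assoc) (simp add: F'_def algebra_simps)
  have 1: "(1 - (E * F') * (F' * E)) ^ Suc m = (1 - E) + (E * F * E) ^ Suc m"
    unfolding eq1 by (rule power_orthogonal_sum) (simp_all add: mult.assoc)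
  have eq2: "1 - (F' * E) * (E * F') = (1 - F') + S"
    unfolding S_def by (simp add: mult.assoc) (simp add: E'_def algebra_simps)
  have 2: "(1 - (F' * E) * (E * F')) ^ Suc m = (1 - F') + S ^ Suc m"
    unfolding eq2 by (rule power_orthogonal_sum) (simp_all add: S_def mult.assoc)
  have "t ((1 - E) + (E * F * E) ^ Suc m) = t ((1 - F') + S ^ Suc m)"
    using t_power_compl_swap[of "E * F'" "F' * E" "Suc m"] unfolding 1 2 by (simp add: mem)
  moreover have "S \<in> N" by (simp add: S_def mem)
  ultimately have eq: "1 - t E + t ((E * F * E) ^ Suc m) = t F + t (S ^ Suc m)"
    by (simp add: t_add t_diff t_one mem F'_def del: power_Suc)
  have "star S = S" by (simp add: S_def mult.assoc)
  then have "S ^ Suc m = star (S ^ n) * S ^ n"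
    using n by (simp only: star_power power_add[symmetric] mult_2)
  then have "0 \<le> Re (t (S ^ Suc m))" using t_pos[of "S ^ n"] \<open>S \<in> N\<close> by (simp add: mem)
  then show ?thesis using arg_cong[OF eq, of Re] unfolding n by simp
qed

text \<open>The clause about Q, stated for arbitrary operators, is the maximality of P: whatever E
  and F both fix is fixed by E F E, by its powers and by their limit. The trace inequality passes to
  the limit from \<open>t_power_sandwich_ge\<close>.\<close>

lemma proj_inf_exists:
  assumes E: "proj E" and F: "proj F"
  shows "\<exists>P. proj P \<and> E * P = P \<and> F * P = P \<and> (\<forall>Q. E * Q = Q \<and> F * Q = Q \<longrightarrow> P * Q = Q)
    \<and> Re (t (1 - P)) \<le> Re (t (1 - E)) + Re (t (1 - F))"
proof -
  note [simp] = projD[OF E] projD[OF F]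
  define S where "S = E * F * E"
  have S: "S \<in> N" "star S = S" by (simp_all add: S_def mem mult.assoc)
  have "norm S \<le> norm (E * F) * norm E" unfolding S_def by (rule norm_mult_ineq)
  also have "\<dots> \<le> (norm E * norm F) * norm E" by (intro mult_right_mono norm_mult_ineq) simp
  also have "\<dots> \<le> 1" by (intro mult_le_one norm_proj E F) (simp_all add: norm_proj E F)
  finally have norm_S: "norm S \<le> 1" .
  obtain P where P: "\<And>x. (\<lambda>n. S ^ (2 * n) \<rhd> x) \<longlonglongrightarrow> P \<rhd> x"
    using selfadjoint_even_power_limit[OF S(2) norm_S] by blast
  have P_mem: "P \<in> N" by (rule limit_mem[OF _ P]) (simp add: mem S)
  have P_star: "star P = P" by (rule star_strong_limit[OF _ P]) (simp add: star_power S)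
  have fixed: "P * Q = Q" if "S * Q = Q" for Q
  proof (rule bop_eqI)
    fix x
    have "S ^ k * Q = Q" for k
      by (induction k) (auto simp: that power_Suc2 mult.assoc simp del: power_Suc)
    then have "S ^ (2 * n) \<rhd> Q \<rhd> x = Q \<rhd> x" for n by (metis app_times)
    then have "(\<lambda>n. Q \<rhd> x) \<longlonglongrightarrow> P \<rhd> Q \<rhd> x" using P[of "Q \<rhd> x"] by simp
    then show "(P * Q) \<rhd> x = Q \<rhd> x" by (simp add: LIMSEQ_const_iff)
  qed
  \<comment> \<open>Multiplication by S^2 only shifts the convergent sequence of even
    powers.\<close>
  have SSP: "S * S * P = P"
  proof (rule bop_eqI)
    fix x
    have "(\<lambda>n. (S * S) \<rhd> S ^ (2 * n) \<rhd> x) \<longlonglongrightarrow> (S * S) \<rhd> P \<rhd> x"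
      by (rule bounded_linear.tendsto[OF bounded_linear_app P])
    moreover have "(\<lambda>n. (S * S) \<rhd> S ^ (2 * n) \<rhd> x) = (\<lambda>n. S ^ (2 * Suc n) \<rhd> x)"
      by (simp add: mult.assoc)
    moreover have "(\<lambda>n. S ^ (2 * Suc n) \<rhd> x) \<longlonglongrightarrow> P \<rhd> x"
      using P[of x] by (rule LIMSEQ_Suc)
    ultimately show "(S * S * P) \<rhd> x = P \<rhd> x" using LIMSEQ_unique by auto
  qed
  have "E * S = S" by (simp add: S_def mult.assoc[symmetric])
  then have EP: "E * P = P" by (metis SSP mult.assoc)
  \<comment> \<open>A vector v in the range of P satisfies v = E F E F v. All factors are
    contractions, so F does not shorten v and therefore fixes it.\<close>
  have FP: "F * P = P"
  proof (rule bop_eqI)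
    fix x
    define v where "v = P \<rhd> x"
    have Ev: "E \<rhd> v = v" unfolding v_def by (metis EP app_times)
    have EE: "E \<rhd> E \<rhd> y = E \<rhd> y" for y by (metis projD(2)[OF E] app_times)
    have "v = (S * S) \<rhd> v" unfolding v_def by (metis SSP app_times)
    also have "\<dots> = E \<rhd> F \<rhd> E \<rhd> F \<rhd> v" by (simp add: S_def Ev EE)
    finally have "norm v = norm (E \<rhd> F \<rhd> E \<rhd> F \<rhd> v)" by simp
    also have "\<dots> \<le> norm (F \<rhd> v)"
      using norm_app_contraction[OF norm_proj[OF E]] norm_app_contraction[OF norm_proj[OF F]]
      by (meson order.trans)
    finally have "F \<rhd> v = v" using idempotent_fixes[of F v] by simp
    then show "(F * P) \<rhd> x = P \<rhd> x" by (simp add: v_def)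
  qed
  have SQ: "S * Q = Q" if "E * Q = Q" "F * Q = Q" for Q
    using that by (simp add: S_def mult.assoc)
  have "P * P = P" by (rule fixed[OF SQ[OF EP FP]])
  then have "proj P" by (simp add: proj_def P_mem P_star)
  moreover have "Re (t (1 - P)) \<le> Re (t (1 - E)) + Re (t (1 - F))"
  proof -
    have "(\<lambda>n. t (S ^ (2 * n))) \<longlonglongrightarrow> t P"
      by (rule t_limit[OF _ _ P, of 1]) (simp_all add: mem S norm_power_contraction norm_S)
    then have "(\<lambda>n. Re (t (S ^ (2 * n)))) \<longlonglongrightarrow> Re (t P)" by (rule tendsto_Re)
    then have "Re (t E) + Re (t F) - 1 \<le> Re (t P)"
      by (rule LIMSEQ_le_const) (use t_power_sandwich_ge[OF E F] in \<open>auto simp: S_def\<close>)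
    then show ?thesis using \<open>proj P\<close> by (simp add: t_proj_compl E F)
  qed
  ultimately show ?thesis using EP FP fixed SQ by blast
qed

definition pinf :: "'h bop \<Rightarrow> 'h bop \<Rightarrow> 'h bop" where
  "pinf E F = (SOME P. proj P \<and> E * P = P \<and> F * P = P \<and> (\<forall>Q. E * Q = Q \<and> F * Q = Q \<longrightarrow> P * Q = Q)
    \<and> Re (t (1 - P)) \<le> Re (t (1 - E)) + Re (t (1 - F)))"

lemma pinf:
  assumes "proj E" "proj F"
  shows "proj (pinf E F)" "E * pinf E F = pinf E F" "F * pinf E F = pinf E F"
    "E * Q = Q \<Longrightarrow> F * Q = Q \<Longrightarrow> pinf E F * Q = Q"
    "Re (t (1 - pinf E F)) \<le> Re (t (1 - E)) + Re (t (1 - F))"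
  using someI_ex[OF proj_inf_exists[OF assms]] unfolding pinf_def by blast+

section \<open>Calculus of measure neighbourhoods\<close>

lemma meas_nbhd_mono: "\<epsilon> \<le> \<epsilon>' \<Longrightarrow> \<delta> \<le> \<delta>' \<Longrightarrow> meas_nbhd \<epsilon> \<delta> \<subseteq> meas_nbhd \<epsilon>' \<delta>'"
  unfolding meas_nbhd_def using order.trans by blast

lemma meas_nbhd_add:
  assumes "A \<in> meas_nbhd \<epsilon> \<delta>" "B \<in> meas_nbhd \<epsilon>' \<delta>'"
  shows "A + B \<in> meas_nbhd (\<epsilon> + \<epsilon>') (\<delta> + \<delta>')"
proof -
  obtain E where A: "A \<in> N" and E: "proj E" "norm (A * E) \<le> \<epsilon>" "Re (t (1 - E)) \<le> \<delta>"
    using assms(1) by (auto simp: meas_nbhd_def)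
  obtain F where B: "B \<in> N" and F: "proj F" "norm (B * F) \<le> \<epsilon>'" "Re (t (1 - F)) \<le> \<delta>'"
    using assms(2) by (auto simp: meas_nbhd_def)
  define P where "P = pinf E F"
  note P = pinf[OF E(1) F(1), folded P_def]
  have shrink: "norm (C * P) \<le> norm (C * G)" if "G * P = P" for C G
  proof -
    have "norm (C * P) = norm (C * G * P)" using that by (simp add: mult.assoc)
    also have "\<dots> \<le> norm (C * G) * norm P" by (rule norm_mult_ineq)
    also have "\<dots> \<le> norm (C * G)" using norm_proj[OF P(1)] by (simp add: mult_left_le)
    finally show ?thesis .
  qed
  have "norm ((A + B) * P) \<le> norm (A * P) + norm (B * P)"
    by (simp add: distrib_right norm_triangle_ineq)
  then have "norm ((A + B) * P) \<le> \<epsilon> + \<epsilon>'"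
    using shrink[OF P(2), of A] shrink[OF P(3), of B] E(2) F(2) by linarith
  moreover have "Re (t (1 - P)) \<le> \<delta> + \<delta>'" using P(5) E(3) F(3) by linarith
  ultimately show ?thesis using P(1) A B by (auto simp: meas_nbhd_def mem)
qed

lemma meas_nbhd_uminus: "A \<in> meas_nbhd \<epsilon> \<delta> \<Longrightarrow> - A \<in> meas_nbhd \<epsilon> \<delta>"
  by (auto simp: meas_nbhd_def mem)

lemma meas_nbhd_diff:
  "A \<in> meas_nbhd \<epsilon> \<delta> \<Longrightarrow> B \<in> meas_nbhd \<epsilon>' \<delta>' \<Longrightarrow> A - B \<in> meas_nbhd (\<epsilon> + \<epsilon>') (\<delta> + \<delta>')"
  using meas_nbhd_add[OF _ meas_nbhd_uminus] by force

lemma meas_nbhd_of_norm: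
  assumes "A \<in> N" "norm A \<le> \<epsilon>" "0 \<le> \<delta>" shows "A \<in> meas_nbhd \<epsilon> \<delta>"
  using assms proj_one by (auto simp: meas_nbhd_def t_zero intro!: exI[of _ 1])

text \<open>Left factors are harmless because E stands to the right of A: the same projection serves
  for the product.\<close>

lemma meas_nbhd_mult:
  assumes "A \<in> meas_nbhd \<epsilon> \<delta>" "B \<in> N" "norm B \<le> b" "0 \<le> b"
  shows "B * A \<in> meas_nbhd (b * \<epsilon>) \<delta>"
proof -
  obtain E where A: "A \<in> N" and E: "proj E" "norm (A * E) \<le> \<epsilon>" "Re (t (1 - E)) \<le> \<delta>"
    using assms(1) by (auto simp: meas_nbhd_def)
  have "norm (B * A * E) \<le> norm B * norm (A * E)" by (simp add: mult.assoc norm_mult_ineq)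
  also have "\<dots> \<le> b * \<epsilon>" by (intro mult_mono) (use assms E in auto)
  finally show ?thesis using A E assms(2) by (auto simp: meas_nbhd_def mem)
qed

section \<open>Sequences of projections\<close>

text \<open>For m <= n the product of E m x and E n x is |E m x|^2, so the squared distance is
  exactly the difference of squared norms, which form a bounded increasing sequence.\<close>

lemma increasing_proj_limit:
  assumes E: "\<And>n. proj (E n)" and inc: "\<And>m n. m \<le> n \<Longrightarrow> E n * E m = E m"
  obtains P where "proj P" "\<And>x. (\<lambda>n. E n \<rhd> x) \<longlonglongrightarrow> P \<rhd> x" "\<And>n. P * E n = E n"
    "(\<lambda>n. Re (t (E n))) \<longlonglongrightarrow> Re (t P)"
proof -
  have inner_eq: "inner (E m \<rhd> x) (E n \<rhd> x) = (norm (E m \<rhd> x))\<^sup>2" if "m \<le> n" for m n x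
  proof -
    have "inner (E m \<rhd> x) (E n \<rhd> x) = inner (E n \<rhd> E m \<rhd> x) x"
      by (simp add: inner_app_right projD[OF E])
    also have "\<dots> = inner (E m \<rhd> E m \<rhd> x) x"
      by (simp add: app_times[symmetric] inc[OF that] projD[OF E] del: app_times)
    also have "\<dots> = (norm (E m \<rhd> x))\<^sup>2"
      by (simp add: inner_app_left[of "E m" "E m \<rhd> x"] projD[OF E] power2_norm_eq_inner)
    finally show ?thesis .
  qed
  have mono: "(norm (E m \<rhd> x))\<^sup>2 \<le> (norm (E n \<rhd> x))\<^sup>2" if "m \<le> n" for m n x
    using zero_le_power2[of "norm (E m \<rhd> x - E n \<rhd> x)"]
    unfolding norm_diff_power2 inner_eq[OF that] by linarith
  have "Cauchy (\<lambda>n. E n \<rhd> x)" for x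
  proof (rule Cauchy_of_square_dist)
    have "(norm (E n \<rhd> x))\<^sup>2 \<le> (norm x)\<^sup>2" for n
      by (intro power_mono norm_app_contraction norm_proj E) simp
    moreover have "incseq (\<lambda>n. (norm (E n \<rhd> x))\<^sup>2)" unfolding incseq_def using mono by blast
    ultimately obtain L where "(\<lambda>n. (norm (E n \<rhd> x))\<^sup>2) \<longlonglongrightarrow> L"
      by (meson incseq_convergent)
    then show "convergent (\<lambda>n. (norm (E n \<rhd> x))\<^sup>2)" by (rule convergentI)
    fix m n :: nat assume "m \<le> n"
    then show "(norm (E m \<rhd> x - E n \<rhd> x))\<^sup>2 \<le> \<bar>(norm (E m \<rhd> x))\<^sup>2 - (norm (E n \<rhd> x))\<^sup>2\<bar>"
      unfolding norm_diff_power2 inner_eq[OF \<open>m \<le> n\<close>] by linarith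
  qed
  then obtain P where P: "\<And>x. (\<lambda>n. E n \<rhd> x) \<longlonglongrightarrow> P \<rhd> x"
    using strong_limit_exists[of E 1] norm_proj[OF E] by blast
  have PE: "P * E m = E m" for m
  proof (rule bop_eqI)
    fix x
    have "\<forall>\<^sub>F n in sequentially. E n \<rhd> E m \<rhd> x = E m \<rhd> x"
      using eventually_ge_at_top[of m]
      by eventually_elim (simp add: app_times[symmetric] inc del: app_times)
    then have "(\<lambda>n. E n \<rhd> E m \<rhd> x) \<longlonglongrightarrow> E m \<rhd> x" by (rule tendsto_eventually)
    then show "(P * E m) \<rhd> x = E m \<rhd> x" using LIMSEQ_unique P[of "E m \<rhd> x"] by simp
  qed
  have "P * P = P"
  proof (rule bop_eqI)
    fix x
    have "(\<lambda>n. P \<rhd> E n \<rhd> x) \<longlonglongrightarrow> P \<rhd> P \<rhd> x"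
      by (rule bounded_linear.tendsto[OF bounded_linear_app P])
    then show "(P * P) \<rhd> x = P \<rhd> x"
      using LIMSEQ_unique P[of x] by (simp add: app_times[symmetric] PE del: app_times)
  qed
  moreover have "star P = P" by (rule star_strong_limit[OF _ P]) (simp add: projD[OF E])
  moreover have "P \<in> N" by (rule limit_mem[OF _ P]) (simp add: projD[OF E])
  ultimately have "proj P" by (simp add: proj_def)
  moreover have "(\<lambda>n. t (E n)) \<longlonglongrightarrow> t P"
    by (rule t_limit[OF _ _ P, of 1]) (simp_all add: projD[OF E] norm_proj[OF E])
  ultimately show ?thesis using that[of P] P PE tendsto_Re by blast
qed

text \<open>\<open>D n\<close> is the meet of E 0, ..., E n. Its complements increase, and F is the
  complement of their limit. Phrasing the trace estimate through a common bound \<open>c\<close> of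
  the partial sums leaves no question of summability.\<close>

lemma countable_proj_inf:
  assumes E: "\<And>n::nat. proj (E n)"
  obtains F where "proj F" "\<And>j. E j * F = F" "\<And>Q. (\<And>j. E j * Q = Q) \<Longrightarrow> F * Q = Q"
    "\<And>c. (\<And>n. (\<Sum>j\<le>n. Re (t (1 - E j))) \<le> c) \<Longrightarrow> Re (t (1 - F)) \<le> c"
proof -
  define D where "D = rec_nat (E 0) (\<lambda>n G. pinf G (E (Suc n)))"
  have D0: "D 0 = E 0" and DS: "D (Suc n) = pinf (D n) (E (Suc n))" for n by (simp_all add: D_def)
  have D: "proj (D n)" for n by (induction n) (simp_all add: D0 DS E pinf)
  have step: "D n * D (Suc n) = D (Suc n)" for n unfolding DS by (rule pinf(2)[OF D E])
  have dec: "D m * D n = D n" if "m \<le> n" for m n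
    using that
  proof (induction n rule: dec_induct)
    case base
    then show ?case by (simp add: projD[OF D])
  next
    case (step n)
    then show ?case using \<open>D n * D (Suc n) = D (Suc n)\<close> by (metis mult.assoc)
  qed
  have sum: "Re (t (1 - D n)) \<le> (\<Sum>j\<le>n. Re (t (1 - E j)))" for n
  proof (induction n)
    case (Suc n)
    then show ?case using pinf(5)[OF D[of n] E[of "Suc n"]] by (simp add: DS)
  qed (simp add: D0)
  have "(1 - D n) * (1 - D m) = 1 - D m" if "m \<le> n" for m n
    using proj_le_sym[OF D D dec[OF that]] by (simp add: algebra_simps)
  then obtain P where P: "proj P" "\<And>x. (\<lambda>n. (1 - D n) \<rhd> x) \<longlonglongrightarrow> P \<rhd> x"
      "\<And>n. P * (1 - D n) = 1 - D n" "(\<lambda>n. Re (t (1 - D n))) \<longlonglongrightarrow> Re (t P)"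
    using increasing_proj_limit[of "\<lambda>n. 1 - D n"] proj_compl[OF D] by blast
  define F where "F = 1 - P"
  have F: "proj F" unfolding F_def by (rule proj_compl[OF P(1)])
  have "D n * P = P - (1 - D n)" for n
    using proj_le_sym[OF P(1) proj_compl[OF D] P(3), of n] by (simp add: algebra_simps)
  then have DF: "D n * F = F" for n by (simp add: F_def algebra_simps)
  have ED: "E n * D n = D n" for n
    by (cases n) (simp_all add: D0 DS projD[OF E] pinf(3)[OF D E])
  have "E j * F = F" for j by (metis DF ED mult.assoc)
  moreover have "F * Q = Q" if Q: "\<And>j. E j * Q = Q" for Q
  proof (rule bop_eqI)
    fix x
    have "D n * Q = Q" for n
      by (induction n) (simp_all add: D0 DS Q pinf(4)[OF D E])
    then have "(1 - D n) \<rhd> Q \<rhd> x = 0" for n by (simp add: app_times[symmetric] left_diff_distrib del: app_times)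
    then have "P \<rhd> Q \<rhd> x = 0" using P(2)[of "Q \<rhd> x"] by (simp add: LIMSEQ_const_iff)
    then show "(F * Q) \<rhd> x = Q \<rhd> x" by (simp add: F_def app_diff_left)
  qed
  moreover have "Re (t (1 - F)) \<le> c" if "\<And>n. (\<Sum>j\<le>n. Re (t (1 - E j))) \<le> c" for c
    using LIMSEQ_le_const2[OF P(4)] sum that by (metis F_def diff_diff_eq2 add_diff_cancel_left' order.trans)
  ultimately show ?thesis using that[of F] F by blast
qed

section \<open>Small and half-sized subprojections\<close>

text \<open>Diffuseness gives F with F and E - F both nonzero; their traces add up to that of E, so
  one of them is at most half.\<close>

lemma exists_half_small_subproj:
  assumes E: "proj E" "E \<noteq> 0"
  shows "\<exists>G. proj G \<and> G \<noteq> 0 \<and> E * G = G \<and> Re (t G) \<le> Re (t E) / 2"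
proof -
  obtain F where F: "proj F" "F \<noteq> 0" "F \<noteq> E" "E * F = F"
    using diffuse[of E] E by (auto simp: proj_def)
  have D: "proj (E - F)" by (rule proj_diff[OF E(1) F(1,4)])
  have "Re (t (E - F)) = Re (t E) - Re (t F)" by (simp add: t_diff projD[OF E(1)] projD[OF F(1)])
  moreover have "E * (E - F) = E - F" by (simp add: right_diff_distrib projD[OF E(1)] F)
  ultimately show ?thesis
    using F D by (cases "Re (t F) \<le> Re (t E) / 2") (force intro: exI[of _ "E - F"])+
qed

lemma exists_small_subproj:
  assumes E: "proj E" "E \<noteq> 0" and "0 < \<eta>"
  shows "\<exists>G. proj G \<and> G \<noteq> 0 \<and> E * G = G \<and> Re (t G) \<le> \<eta>"
proof -
  have iter: "\<exists>G. proj G \<and> G \<noteq> 0 \<and> E * G = G \<and> Re (t G) \<le> Re (t E) / 2 ^ n" for n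
  proof (induction n)
    case 0
    then show ?case using E by (auto simp: projD[OF E(1)] intro!: exI[of _ E])
  next
    case (Suc n)
    then obtain G where G: "proj G" "G \<noteq> 0" "E * G = G" "Re (t G) \<le> Re (t E) / 2 ^ n" by blast
    obtain G' where G': "proj G'" "G' \<noteq> 0" "G * G' = G'" "Re (t G') \<le> Re (t G) / 2"
      using exists_half_small_subproj[OF G(1,2)] by blast
    have "E * G' = G'" by (metis G(3) G'(3) mult.assoc)
    moreover have "Re (t G') \<le> Re (t E) / 2 ^ Suc n" using G(4) G'(4) by simp
    ultimately show ?case using G' by blast
  qed
  have "(\<lambda>n. Re (t E) * (1 / 2) ^ n) \<longlonglongrightarrow> Re (t E) * 0"
    by (intro tendsto_mult tendsto_const LIMSEQ_power_zero) simp
  then have "\<forall>\<^sub>F n in sequentially. Re (t E) * (1 / 2) ^ n < \<eta>"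
    using \<open>0 < \<eta>\<close> by (auto dest: order_tendstoD(2))
  then obtain n where "Re (t E) * (1 / 2) ^ n < \<eta>" by (auto simp: eventually_sequentially)
  then show ?thesis using iter[of n] by (force simp: power_one_over)
qed

text \<open>Exhaustion by sequences in place of a maximality principle: starting from 0, each
  admissible projection is enlarged so as to realise at least half of the gain still possible, and
  the limit admits no further gain.\<close>

lemma exists_half_proj:
  assumes E: "proj E"
  shows "\<exists>F. proj F \<and> E * F = F \<and> t F = t E / 2"
proof -
  define adm where "adm F \<longleftrightarrow> proj F \<and> E * F = F \<and> Re (t F) \<le> Re (t E) / 2" for F
  have step: "\<exists>F'. adm F' \<and> F' * F = F
      \<and> (\<forall>G. adm G \<and> G * F = F \<longrightarrow> Re (t G) - Re (t F) \<le> 2 * (Re (t F') - Re (t F)))"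
    if "adm F" for F
  proof -
    define S where "S = {Re (t G) | G. adm G \<and> G * F = F}"
    have FS: "Re (t F) \<in> S" using that by (auto simp: S_def adm_def projD(2))
    have bdd: "bdd_above S" by (auto simp: S_def adm_def intro!: bdd_aboveI[of _ "Re (t E) / 2"])
    have upper: "Re (t G) \<le> Sup S" if "adm G" "G * F = F" for G
      by (rule cSup_upper[OF _ bdd]) (use that in \<open>auto simp: S_def\<close>)
    show ?thesis
    proof (cases "Sup S = Re (t F)")
      case True
      then show ?thesis using that upper by (intro exI[of _ F]) (auto simp: adm_def projD(2))
    next
      case False
      \<comment> \<open>The supremum need not be attained. Passing the midpoint between t F and
        \<open>Sup S\<close> is enough and accounts for the factor 2.\<close>
      then have "(Sup S + Re (t F)) / 2 < Sup S" using cSup_upper[OF FS bdd] by simp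
      then obtain r where "r \<in> S" "(Sup S + Re (t F)) / 2 < r"
        using less_cSupE[of _ S] FS by blast
      then obtain F' where "adm F'" "F' * F = F" "(Sup S + Re (t F)) / 2 < Re (t F')"
        by (auto simp: S_def)
      then show ?thesis using upper by (intro exI[of _ F']) fastforce
    qed
  qed
  have "adm 0" by (simp add: adm_def proj_zero t_zero t_proj_ge_0 E)
  then obtain F where adm: "\<And>n. adm (F n)" and F_Suc: "\<And>n. F (Suc n) * F n = F n"
    and F_greedy: "\<And>n G. adm G \<Longrightarrow> G * F n = F n \<Longrightarrow>
        Re (t G) - Re (t (F n)) \<le> 2 * (Re (t (F (Suc n))) - Re (t (F n)))"
    using dependent_nat_choice[of "\<lambda>_. adm" "\<lambda>_ F F'. F' * F = F \<and>
      (\<forall>G. adm G \<and> G * F = F \<longrightarrow> Re (t G) - Re (t F) \<le> 2 * (Re (t F') - Re (t F)))"] step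
    by (metis (no_types, lifting))
  have F: "proj (F n)" "E * F n = F n" "Re (t (F n)) \<le> Re (t E) / 2" for n
    using adm[of n] by (auto simp: adm_def)
  have inc: "F n * F m = F m" if "m \<le> n" for m n
    using that
  proof (induction n rule: dec_induct)
    case base
    then show ?case by (simp add: projD[OF F(1)])
  next
    case (step n)
    then show ?case by (metis F_Suc mult.assoc)
  qed
  obtain P where P: "proj P" "\<And>x. (\<lambda>n. F n \<rhd> x) \<longlonglongrightarrow> P \<rhd> x" "\<And>n. P * F n = F n"
    "(\<lambda>n. Re (t (F n))) \<longlonglongrightarrow> Re (t P)"
    using increasing_proj_limit[of F] F(1) inc by blast
  have EP: "E * P = P"
  proof (rule bop_eqI)
    fix x
    have "(\<lambda>n. E \<rhd> F n \<rhd> x) \<longlonglongrightarrow> E \<rhd> P \<rhd> x"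
      by (rule bounded_linear.tendsto[OF bounded_linear_app P(2)])
    then show "(E * P) \<rhd> x = P \<rhd> x"
      using LIMSEQ_unique P(2)[of x] by (simp add: app_times[symmetric] F(2) del: app_times)
  qed
  have "Re (t P) \<le> Re (t E) / 2" using LIMSEQ_le_const2[OF P(4)] F(3) by blast
  moreover have "\<not> Re (t P) < Re (t E) / 2"
  proof
    assume less: "Re (t P) < Re (t E) / 2"
    have PE: "P * E = P" by (rule proj_le_sym[OF E P(1) EP])
    \<comment> \<open>G is chosen within the deficit, so \<open>P + G\<close> is still admissible
      and lies above every \<open>F n\<close>. By greediness its gain is at most twice the increment
      of the traces, which tends to 0, while G has positive trace.\<close>
    have "E - P \<noteq> 0" using less t_proj_ge_0[OF E] by auto
    then obtain G where G: "proj G" "G \<noteq> 0" "(E - P) * G = G" "Re (t G) \<le> Re (t E) / 2 - Re (t P)"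
      using exists_small_subproj[OF proj_diff[OF E P(1) EP], of "Re (t E) / 2 - Re (t P)"] less by auto
    have "P * (E - P) = 0" by (simp add: right_diff_distrib PE projD[OF P(1)])
    then have PG: "P * G = 0" by (metis G(3) mult.assoc mult_zero_left)
    then have GP: "G * P = 0" by (metis projD(3)[OF P(1)] projD(3)[OF G(1)] star_mult star_zero)
    have EG: "E * G = G" using G(3) PG by (simp add: left_diff_distrib)
    have "proj (P + G)" using P(1) G(1) PG GP by (auto simp: proj_def mem algebra_simps)
    then have "adm (P + G)"
      using EP EG G(4) by (simp add: adm_def distrib_left t_add projD[OF P(1)] projD[OF G(1)])
    moreover have "(P + G) * F n = F n" for n
      by (metis (no_types, lifting) GP P(3) add.right_neutral distrib_right mult.assoc mult_zero_left)
    ultimately have le: "Re (t (P + G)) - Re (t (F n)) \<le> 2 * (Re (t (F (Suc n))) - Re (t (F n)))" for n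
      by (rule F_greedy)
    have "(\<lambda>n. Re (t (P + G)) - Re (t (F n))) \<longlonglongrightarrow> Re (t (P + G)) - Re (t P)"
      by (intro tendsto_diff tendsto_const P(4))
    moreover have "(\<lambda>n. 2 * (Re (t (F (Suc n))) - Re (t (F n)))) \<longlonglongrightarrow> 2 * (Re (t P) - Re (t P))"
      by (intro tendsto_mult tendsto_diff tendsto_const P(4) LIMSEQ_Suc[OF P(4)])
    ultimately have "Re (t (P + G)) - Re (t P) \<le> 2 * (Re (t P) - Re (t P))"
      by (rule LIMSEQ_le) (use le in blast)
    then show False
      using t_proj_pos[OF G(1,2)] by (simp add: t_add projD[OF P(1)] projD[OF G(1)])
  qed
  ultimately have "t P = t E / 2"
    by (simp add: complex_eq_iff t_proj_real P(1) E)
  then show ?thesis using P(1) EP by blast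
qed

section \<open>Rademacher unitaries\<close>

definition half :: "'h bop \<Rightarrow> 'h bop" where
  "half E = (SOME F. proj F \<and> E * F = F \<and> t F = t E / 2)"

lemma half:
  assumes "proj E"
  shows "proj (half E)" "E * half E = half E" "t (half E) = t E / 2"
  using someI_ex[OF exists_half_proj[OF assms]] unfolding half_def by blast+

text \<open>\<open>rademacher n 1\<close> is the \<open>n\<close>-th Rademacher function of the dyadic tree of projections
  generated by \<open>half\<close>.\<close>
primrec rademacher :: "nat \<Rightarrow> 'h bop \<Rightarrow> 'h bop" where
  "rademacher 0 E = half E - (E - half E)"
| "rademacher (Suc n) E = rademacher n (half E) + rademacher n (E - half E)"

text \<open>The element is a trace-zero selfadjoint unitary of the corner of E. The corner
  identities belong to the induction because they annihilate the cross terms between the two halves;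
  E is arbitrary because the recursion passes to those halves.\<close>

lemma rademacher:
  assumes "proj E"
  shows "rademacher n E \<in> N \<and> star (rademacher n E) = rademacher n E
    \<and> rademacher n E * rademacher n E = E
    \<and> E * rademacher n E = rademacher n E \<and> rademacher n E * E = rademacher n E
    \<and> t (rademacher n E) = 0"
  using assms
proof (induction n arbitrary: E)
  case (0 E)
  note h = half[OF 0] and hE = proj_le_sym[OF 0 half(1,2)[OF 0]]
  show ?case
    using h hE projD[OF 0] projD[OF h(1)] by (auto simp: mem algebra_simps t_add t_diff)
next
  case (Suc n E)
  note h = half[OF Suc.prems]
  define F where "F = half E"
  define G where "G = E - half E"
  have F: "proj F" and G: "proj G" unfolding F_def G_def
    by (rule h(1), rule proj_diff[OF Suc.prems h(1,2)])
  have EF: "E * F = F" "F * E = F"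
    using h(2) proj_le_sym[OF Suc.prems h(1,2)] by (simp_all add: F_def)
  have FG: "F * G = 0" "G * F = 0" "E * G = G" "G * E = G" "F + G = E"
    using EF projD[OF F] projD[OF Suc.prems] by (simp_all add: G_def F_def[symmetric] algebra_simps)
  define X where "X = rademacher n F"
  define Y where "Y = rademacher n G"
  note X = Suc.IH[OF F, folded X_def] and Y = Suc.IH[OF G, folded Y_def]
  have "X * Y = 0" "Y * X = 0"
    using X Y FG mult_orthogonal_corners[of X F G Y] mult_orthogonal_corners[of Y G F X] by auto
  moreover have "E * X = X" "X * E = X" "E * Y = Y" "Y * E = Y"
    using X Y FG EF mult_absorb_left[of F X E] mult_absorb_right[of X F E]
      mult_absorb_left[of G Y E] mult_absorb_right[of Y G E] by auto
  moreover have "rademacher (Suc n) E = X + Y" by (simp add: X_def Y_def F_def G_def)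
  ultimately show ?case using X Y FG by (simp add: mem algebra_simps t_add)
qed

text \<open>At level 0 the first factor is +1 on one half and -1 on the other, while the second has
  trace 0 on each half. At higher levels the product splits over the halves, and induction applies
  to each.\<close>

lemma rademacher_orthogonal:
  assumes "proj E" "m < n"
  shows "t (rademacher m E * rademacher n E) = 0"
  using assms
proof (induction m arbitrary: n E)
  case (0 n E)
  then obtain k where n: "n = Suc k" by (cases n) auto
  note h = half[OF 0(1)] and hE = proj_le_sym[OF 0(1) half(1,2)[OF 0(1)]]
  define F where "F = half E"
  define G where "G = E - half E"
  have F: "proj F" and G: "proj G" unfolding F_def G_def
    by (rule h(1), rule proj_diff[OF 0(1) h(1,2)])
  have FG: "F * G = 0" "G * F = 0"
    using h hE projD[OF F] projD[OF 0(1)] by (simp_all add: G_def F_def[symmetric] algebra_simps)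
  define X where "X = rademacher k F"
  define Y where "Y = rademacher k G"
  note X = rademacher[OF F, of k, folded X_def] and Y = rademacher[OF G, of k, folded Y_def]
  have "F * Y = 0" "G * X = 0" using X Y FG by (metis mult.assoc mult_zero_left)+
  then have "(F - G) * (X + Y) = X - Y" using X Y by (simp add: algebra_simps)
  then have "rademacher 0 E * rademacher n E = X - Y"
    by (simp add: n X_def Y_def F_def G_def)
  then show ?case using X Y by (simp add: t_diff)
next
  case (Suc m n E)
  then obtain k where n: "n = Suc k" "m < k" by (cases n) auto
  note h = half[OF Suc.prems(1)] and hE = proj_le_sym[OF Suc.prems(1) half(1,2)[OF Suc.prems(1)]]
  define F where "F = half E"
  define G where "G = E - half E"
  have F: "proj F" and G: "proj G" unfolding F_def G_def
    by (rule h(1), rule proj_diff[OF Suc.prems(1) h(1,2)])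
  have FG: "F * G = 0" "G * F = 0"
    using h hE projD[OF F] projD[OF Suc.prems(1)] by (simp_all add: G_def F_def[symmetric] algebra_simps)
  note X = rademacher[OF F] and Y = rademacher[OF G]
  have "rademacher m F * rademacher k G = 0" "rademacher m G * rademacher k F = 0"
    using X Y FG mult_orthogonal_corners[of "rademacher m F" F G "rademacher k G"]
      mult_orthogonal_corners[of "rademacher m G" G F "rademacher k F"] by auto
  moreover have "rademacher (Suc m) E = rademacher m F + rademacher m G"
    "rademacher n E = rademacher k F + rademacher k G"
    by (simp_all add: n F_def G_def)
  ultimately have "rademacher (Suc m) E * rademacher n E
      = rademacher m F * rademacher k F + rademacher m G * rademacher k G"
    by (simp add: distrib_left distrib_right)
  then show ?case
    using Suc.IH[OF F n(2)] Suc.IH[OF G n(2)] X Y by (simp add: t_add mem)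
qed

lemma norm_rademacher: "norm (rademacher n 1) \<le> 1"
proof (rule norm_bop_le)
  fix x
  note U = rademacher[OF proj_one, of n]
  have "(norm (rademacher n 1 \<rhd> x))\<^sup>2 = inner x (rademacher n 1 \<rhd> rademacher n 1 \<rhd> x)"
    using U by (simp add: power2_norm_eq_inner inner_app_left)
  also have "\<dots> = (norm x)\<^sup>2"
    using U by (simp add: app_times[symmetric] power2_norm_eq_inner del: app_times)
  finally show "norm (rademacher n 1 \<rhd> x) \<le> 1 * norm x" by simp
qed simp

text \<open>The difference X has trace 0, which reveals nothing, but by orthogonality
  \<open>X * X\<close> has trace 2. Membership of X would place \<open>X * X\<close>, of norm at
  most 4, in a neighbourhood where \<open>t_meas_nbhd_le\<close> forces a smaller trace.\<close>

lemma rademacher_separated: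
  obtains \<epsilon> \<delta> where "0 < \<epsilon>" "0 < \<delta>"
    "\<And>m n. m \<noteq> n \<Longrightarrow> rademacher m 1 - rademacher n 1 \<notin> meas_nbhd \<epsilon> \<delta>"
proof -
  \<comment> \<open>With |X| <= 2 and |X X|^2 <= 16 the estimate is 2 K \<epsilon> + sqrt \<delta>
    (16 K + 1). These choices bound it by 1/2 + 1, below the trace 2.\<close>
  define \<epsilon> where "\<epsilon> = 1 / (4 * (K + 1))"
  define \<delta> where "\<delta> = (1 / (16 * K + 1))\<^sup>2"
  have pos: "0 < \<epsilon>" "0 < \<delta>" using K_nonneg by (simp_all add: \<epsilon>_def \<delta>_def)
  have "rademacher m 1 - rademacher n 1 \<notin> meas_nbhd \<epsilon> \<delta>" if "m \<noteq> n" for m n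
  proof
    define X where "X = rademacher m 1 - rademacher n 1"
    assume "rademacher m 1 - rademacher n 1 \<in> meas_nbhd \<epsilon> \<delta>"
    then have X: "X \<in> meas_nbhd \<epsilon> \<delta>" by (simp add: X_def)
    note U = rademacher[OF proj_one, of m] and V = rademacher[OF proj_one, of n]
    have X_mem: "X \<in> N" using U V by (simp add: X_def mem)
    have norm_X: "norm X \<le> 2"
      using norm_triangle_ineq4[of "rademacher m 1" "rademacher n 1"] norm_rademacher[of m] norm_rademacher[of n]
      unfolding X_def by linarith
    have XX: "X * X \<in> meas_nbhd (2 * \<epsilon>) \<delta>"
      by (rule meas_nbhd_mult[OF X X_mem norm_X]) simp
    have "norm (X * X) \<le> 2 * 2"
      using norm_X by (intro order.trans[OF norm_mult_ineq] mult_mono) auto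
    then have norm_XX: "(norm (X * X))\<^sup>2 \<le> 16"
      using power_mono[of "norm (X * X)" 4 2] by simp
    have "t (rademacher m 1 * rademacher n 1) = 0"
    proof (cases "m < n")
      case True
      then show ?thesis by (rule rademacher_orthogonal[OF proj_one])
    next
      case False
      then have "t (rademacher n 1 * rademacher m 1) = 0"
        using \<open>m \<noteq> n\<close> by (intro rademacher_orthogonal[OF proj_one]) simp
      then show ?thesis using t_comm[of "rademacher n 1" "rademacher m 1"] U V by simp
    qed
    moreover have "t (rademacher n 1 * rademacher m 1) = t (rademacher m 1 * rademacher n 1)"
      using U V by (simp add: t_comm)
    moreover have "X * X = 1 + 1 - rademacher m 1 * rademacher n 1 - rademacher n 1 * rademacher m 1"
      using U V by (simp add: X_def algebra_simps)
    ultimately have "t (X * X) = 2"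
      using U V by (simp add: t_diff t_add mem t_one)
    then have "2 \<le> K * (2 * \<epsilon>) + sqrt \<delta> * (K * (norm (X * X))\<^sup>2 + 1)"
      using t_meas_nbhd_le[OF XX pos(2)] by simp
    also have "\<dots> \<le> K * (2 * \<epsilon>) + sqrt \<delta> * (K * 16 + 1)"
      using norm_XX K_nonneg pos(2) by (intro add_left_mono mult_left_mono add_right_mono) auto
    also have "K * (2 * \<epsilon>) \<le> 1 / 2"
      using K_nonneg by (simp add: \<epsilon>_def field_simps)
    also have "sqrt \<delta> * (K * 16 + 1) = 1"
      using K_nonneg by (simp add: \<delta>_def real_sqrt_abs mult.commute)
    finally show False by simp
  qed
  then show ?thesis using that[of \<epsilon> \<delta>] pos by blast
qed

section \<open>Completeness for sequences\<close>

text \<open>\<open>F k\<close> is the meet of all E j with j >= k. One projection then controls all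
  later steps at once, and its complement has trace at most the geometric tail 2 * 2^-k. Maximality
  of these meets is what makes them increase.\<close>

lemma measure_complete_sequence:
  assumes A: "\<And>n. A n \<in> N" "\<And>n. norm (A n) \<le> 1"
    and step: "\<And>n. A (Suc n) - A n \<in> meas_nbhd ((1 / 2) ^ n) ((1 / 2) ^ n)"
  obtains L where "L \<in> N" "norm L \<le> 1" "\<And>n. A n - L \<in> meas_nbhd (2 * (1 / 2) ^ n) (2 * (1 / 2) ^ n)"
proof -
  obtain E where E: "\<And>n. proj (E n)" "\<And>n. norm ((A (Suc n) - A n) * E n) \<le> (1 / 2) ^ n"
      "\<And>n. Re (t (1 - E n)) \<le> (1 / 2) ^ n"
    using step unfolding meas_nbhd_def by (simp, metis)
  have "\<exists>F. proj F \<and> (\<forall>j. E (k + j) * F = F) \<and> (\<forall>Q. (\<forall>j. E (k + j) * Q = Q) \<longrightarrow> F * Q = Q)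
    \<and> Re (t (1 - F)) \<le> 2 * (1 / 2) ^ k" for k
  proof -
    obtain F where F: "proj F" "\<And>j. E (k + j) * F = F"
      "\<And>Q. (\<And>j. E (k + j) * Q = Q) \<Longrightarrow> F * Q = Q"
      "\<And>c. (\<And>n. (\<Sum>j\<le>n. Re (t (1 - E (k + j)))) \<le> c) \<Longrightarrow> Re (t (1 - F)) \<le> c"
      using countable_proj_inf[of "\<lambda>j. E (k + j)"] E(1) by blast
    have "(\<Sum>j\<le>n. Re (t (1 - E (k + j)))) \<le> 2 * (1 / 2) ^ k" for n
    proof -
      have "(\<Sum>j\<le>n. Re (t (1 - E (k + j)))) \<le> (\<Sum>j\<le>n. (1 / 2) ^ k * (1 / 2) ^ j)"
        by (intro sum_mono) (use E(3) in \<open>auto simp: power_add[symmetric]\<close>)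
      also have "\<dots> = (1 / 2) ^ k * (\<Sum>j\<le>n. (1 / 2) ^ j)" by (rule sum_distrib_left[symmetric])
      also have "(\<Sum>j\<le>n. (1 / 2) ^ j) = 2 - (1 / 2 :: real) ^ n"
        by (induction n) auto
      also have "(1 / 2) ^ k * (2 - (1 / 2 :: real) ^ n) \<le> (1 / 2) ^ k * 2"
        by (intro mult_left_mono) auto
      finally show ?thesis by simp
    qed
    then show ?thesis using F by metis
  qed
  then obtain F where F: "\<And>k. proj (F k)" "\<And>k j. E (k + j) * F k = F k"
    "\<And>k Q. (\<And>j. E (k + j) * Q = Q) \<Longrightarrow> F k * Q = Q" "\<And>k. Re (t (1 - F k)) \<le> 2 * (1 / 2) ^ k"
    by metis
  have EF: "E n * F k = F k" if "k \<le> n" for k n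
    using F(2)[of k "n - k"] that by simp
  have inc: "F n * F m = F m" if "m \<le> n" for m n
    by (rule F(3)) (use that in \<open>simp add: EF\<close>)
  obtain G where G: "proj G" "\<And>x. (\<lambda>n. F n \<rhd> x) \<longlonglongrightarrow> G \<rhd> x" "\<And>n. G * F n = F n"
    "(\<lambda>n. Re (t (F n))) \<longlonglongrightarrow> Re (t G)"
    using increasing_proj_limit[of F] F(1) inc by blast
  \<comment> \<open>Faithfulness enters here: the traces of \<open>1 - F n\<close> tend to 0, so
    \<open>1 - G\<close> has trace 0.\<close>
  have "G = 1"
  proof (rule ccontr)
    assume "G \<noteq> 1"
    then have "0 < Re (t (1 - G))" by (intro t_proj_pos proj_compl G(1)) simp
    moreover have "(\<lambda>n. 2 * (1 / 2 :: real) ^ n) \<longlonglongrightarrow> 2 * 0"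
      by (intro tendsto_mult tendsto_const LIMSEQ_power_zero) simp
    moreover have "(\<lambda>n. 1 - Re (t (F n))) \<longlonglongrightarrow> 1 - Re (t G)"
      by (intro tendsto_diff tendsto_const G(4))
    ultimately show False
      using F(4) LIMSEQ_le[of "\<lambda>n. 1 - Re (t (F n))" "1 - Re (t G)" "\<lambda>n. 2 * (1 / 2) ^ n" "2 * 0"]
      by (auto simp: t_proj_compl F(1) G(1))
  qed
  then have dense: "(\<lambda>n. F n \<rhd> x) \<longlonglongrightarrow> x" for x using G(2)[of x] by simp
  \<comment> \<open>The right side is the exact sum of 2^-j for m <= j < n, kept exact so that the
    induction closes.\<close>
  have telescope: "norm ((A n - A m) * F k) \<le> 2 * (1 / 2) ^ m - 2 * (1 / 2) ^ n" if "k \<le> m" "m \<le> n" for k m n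
    using that(2)
  proof (induction n rule: dec_induct)
    case base
    then show ?case by simp
  next
    case (step n)
    have "(A (Suc n) - A n) * F k = (A (Suc n) - A n) * E n * F k"
      using EF[of k n] step that by (simp add: mult.assoc)
    then have "norm ((A (Suc n) - A n) * F k) \<le> norm ((A (Suc n) - A n) * E n) * norm (F k)"
      by (simp only: norm_mult_ineq)
    also have "\<dots> \<le> (1 / 2) ^ n * 1"
      by (intro mult_mono E norm_proj F) auto
    finally have "norm ((A (Suc n) - A n) * F k) \<le> (1 / 2) ^ n" by simp
    moreover have "(A (Suc n) - A m) * F k = (A n - A m) * F k + (A (Suc n) - A n) * F k"
      by (simp add: algebra_simps)
    ultimately show ?case
      using step.IH norm_triangle_ineq[of "(A n - A m) * F k" "(A (Suc n) - A n) * F k"] by simp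
  qed
  have close: "norm ((A n - A m) \<rhd> F k \<rhd> x) \<le> 2 * (1 / 2) ^ m * norm x" if "k \<le> m" "m \<le> n" for k m n x
  proof -
    have "norm ((A n - A m) * F k) \<le> 2 * (1 / 2) ^ m"
      using telescope[OF that] zero_le_power[of "1 / 2 :: real" n] by linarith
    then show ?thesis
      using norm_app[of "(A n - A m) * F k" x] mult_right_mono[of _ _ "norm x"] by fastforce
  qed
  have "Cauchy (\<lambda>n. A n \<rhd> x)" for x
  proof (rule CauchyI)
    fix e :: real assume e: "0 < e"
    have "\<forall>\<^sub>F k in sequentially. norm (F k \<rhd> x - x) < e / 8"
      using tendstoD[OF dense[of x], of "e / 8"] e by (simp add: dist_norm)
    then obtain k where k: "norm (F k \<rhd> x - x) < e / 8" by (auto simp: eventually_sequentially)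
    have "(\<lambda>n. 2 * (1 / 2 :: real) ^ n * norm x) \<longlonglongrightarrow> 2 * 0 * norm x"
      by (intro tendsto_mult tendsto_const LIMSEQ_power_zero) simp
    then have "\<forall>\<^sub>F m in sequentially. 2 * (1 / 2 :: real) ^ m * norm x < e / 4"
      using e by (intro order_tendstoD(2)) auto
    then obtain m0 where m0: "\<And>m. m0 \<le> m \<Longrightarrow> 2 * (1 / 2 :: real) ^ m * norm x < e / 4"
      by (auto simp: eventually_sequentially)
    have le: "norm (A n \<rhd> x - A m \<rhd> x) < e" if "max k m0 \<le> m" "m \<le> n" for m n
    proof -
      \<comment> \<open>Replacing x by \<open>F k \<rhd> x\<close> costs less than e/8 for each of
        the contractions A n and A m; on the range of \<open>F k\<close> the estimate
        \<open>close\<close> applies.\<close>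
      have "A n \<rhd> x - A m \<rhd> x = (A n - A m) \<rhd> F k \<rhd> x - (A n \<rhd> (F k \<rhd> x - x) - A m \<rhd> (F k \<rhd> x - x))"
        by (simp add: app_diff app_diff_left)
      then have "norm (A n \<rhd> x - A m \<rhd> x) \<le> norm ((A n - A m) \<rhd> F k \<rhd> x)
          + (norm (A n \<rhd> (F k \<rhd> x - x)) + norm (A m \<rhd> (F k \<rhd> x - x)))"
        using norm_triangle_ineq4 by (metis (no_types, lifting) add_left_mono order.trans)
      moreover have "norm ((A n - A m) \<rhd> F k \<rhd> x) < e / 4"
        using close[of k m n x] m0[of m] that by simp
      moreover have "norm (A n \<rhd> (F k \<rhd> x - x)) < e / 8" "norm (A m \<rhd> (F k \<rhd> x - x)) < e / 8"
        using norm_app_contraction[OF A(2)] k le_less_trans by blast+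
      ultimately show ?thesis using e by linarith
    qed
    show "\<exists>M. \<forall>m\<ge>M. \<forall>n\<ge>M. norm (A m \<rhd> x - A n \<rhd> x) < e"
      using le by (metis nle_le norm_minus_commute)
  qed
  then obtain L where L: "\<And>x. (\<lambda>n. A n \<rhd> x) \<longlonglongrightarrow> L \<rhd> x" "norm L \<le> 1"
    using strong_limit_exists[of A 1] A(2) by blast
  have L_mem: "L \<in> N" by (rule limit_mem[OF A(1) L(1)])
  have "A m - L \<in> meas_nbhd (2 * (1 / 2) ^ m) (2 * (1 / 2) ^ m)" for m
  proof -
    \<comment> \<open>Letting n grow in \<open>close\<close> upgrades strong convergence to
      convergence in measure, with \<open>F m\<close> as the witnessing projection.\<close>
    have "norm ((A m - L) * F m) \<le> 2 * (1 / 2) ^ m"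
    proof (rule norm_bop_le)
      fix x
      have "(\<lambda>n. norm ((A n - A m) \<rhd> F m \<rhd> x)) \<longlonglongrightarrow> norm ((L - A m) \<rhd> F m \<rhd> x)"
        unfolding app_diff_left by (intro tendsto_norm tendsto_diff tendsto_const L(1))
      then have "norm ((L - A m) \<rhd> F m \<rhd> x) \<le> 2 * (1 / 2) ^ m * norm x"
        by (rule LIMSEQ_le_const2) (use close[of m m] in blast)
      then show "norm (((A m - L) * F m) \<rhd> x) \<le> 2 * (1 / 2) ^ m * norm x"
        by (simp add: app_diff_left norm_minus_commute)
    qed simp
    then show ?thesis using F(1,4) A(1) L_mem by (auto simp: meas_nbhd_def mem)
  qed
  then show ?thesis using that[of L] L_mem L(2) by blast
qed

end

section \<open>The ultraweak and measure topologies\<close>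

lemma cinner_raw: "cinner (raw x) (raw y) = Complex (inner x y) (inner (cscale \<i> x) y)"
  by (rule complex_eqI; transfer) (simp_all add: cinner_scaleC_left)

text \<open>The factor 2 comes from estimating real and imaginary parts separately.\<close>

lemma cmod_cinner_le: "cmod (cinner x y) \<le> 2 * (hnorm x * hnorm y)"
proof -
  have "\<bar>inner (Hvec x) (Hvec y)\<bar> \<le> hnorm x * hnorm y"
    using Cauchy_Schwarz_ineq2[of "Hvec x" "Hvec y"] by (simp add: norm_Hvec)
  moreover have "\<bar>inner (cscale \<i> (Hvec x)) (Hvec y)\<bar> \<le> hnorm x * hnorm y"
    using Cauchy_Schwarz_ineq2[of "cscale \<i> (Hvec x)" "Hvec y"] by (simp add: norm_Hvec norm_cscale)
  ultimately show ?thesis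
    using cmod_le[of "cinner x y"] cinner_raw[of "Hvec x" "Hvec y"] by (simp add: Hvec_inverse)
qed

text \<open>The inequality 2 a b <= a^2 + b^2 produces a summable majorant that depends on A only
  through the norm bound, as dominated convergence requires.\<close>

lemma ultraweak_term_le:
  assumes "norm A \<le> b"
  shows "cmod (cinner y (fn A x)) \<le> b * ((hnorm x)\<^sup>2 + (hnorm y)\<^sup>2)"
proof -
  have b: "0 \<le> b" using assms norm_ge_zero order.trans by blast
  have pos: "0 \<le> hnorm y" "0 \<le> hnorm x" by (simp_all add: norm_Hvec[symmetric])
  have "hnorm (fn A x) \<le> norm A * hnorm x"
    using norm_app[of A "Hvec x"] by (simp add: fn_eq_app hnorm_raw norm_Hvec)
  also have "\<dots> \<le> b * hnorm x" by (intro mult_right_mono assms pos)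
  finally have "cmod (cinner y (fn A x)) \<le> 2 * (hnorm y * (b * hnorm x))"
    using cmod_cinner_le[of y "fn A x"] mult_left_mono[OF _ pos(1)] by fastforce
  also have "\<dots> = b * (2 * (hnorm x * hnorm y))" by simp
  also have "2 * (hnorm x * hnorm y) \<le> (hnorm x)\<^sup>2 + (hnorm y)\<^sup>2"
    using sum_squares_bound[of "hnorm x" "hnorm y"] by (simp add: mult.assoc)
  finally show ?thesis using b by (simp add: mult_left_mono)
qed

lemma ultraweak_functional_summable:
  assumes "summable (\<lambda>n. (hnorm (x n))\<^sup>2)" "summable (\<lambda>n. (hnorm (y n))\<^sup>2)"
  shows "summable (\<lambda>n. cinner (y n) (fn A (x n)))"
  by (rule summable_comparison_test'[OF summable_mult[OF summable_add[OF assms]]])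
    (rule ultraweak_term_le[OF order.refl])

lemma ultraweak_functional_diff:
  assumes "\<omega> \<in> ultraweak_functionals"
  shows "\<omega> (fn (A - B)) = \<omega> (fn A) - \<omega> (fn B)"
proof -
  obtain x y where \<omega>: "\<omega> = (\<lambda>A. \<Sum>n. cinner (y n) (A (x n)))"
    and s: "summable (\<lambda>n. (hnorm (x n))\<^sup>2)" "summable (\<lambda>n. (hnorm (y n))\<^sup>2)"
    using assms by (auto simp: ultraweak_functionals_def)
  have "cinner (y n) (fn (A - B) (x n)) = cinner (y n) (fn A (x n)) - cinner (y n) (fn B (x n))" for n
    using cinner_add_right[of "y n" "fn (A - B) (x n)" "fn B (x n)"]
    by (simp add: minus_bop.rep_eq op_diff_def)
  then show ?thesis
    using suminf_diff[OF ultraweak_functional_summable[OF s] ultraweak_functional_summable[OF s]]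
    by (simp add: \<omega>)
qed

lemma ultraweak_functional_le:
  assumes "\<omega> \<in> ultraweak_functionals"
  obtains c where "\<And>A. norm A \<le> 1 \<Longrightarrow> cmod (\<omega> (fn A)) \<le> c"
proof -
  obtain x y where \<omega>: "\<omega> = (\<lambda>A. \<Sum>n. cinner (y n) (A (x n)))"
    and s: "summable (\<lambda>n. (hnorm (x n))\<^sup>2)" "summable (\<lambda>n. (hnorm (y n))\<^sup>2)"
    using assms by (auto simp: ultraweak_functionals_def)
  have "cmod (\<omega> (fn A)) \<le> (\<Sum>n. 1 * ((hnorm (x n))\<^sup>2 + (hnorm (y n))\<^sup>2))" if "norm A \<le> 1" for A
    unfolding \<omega>
    by (rule norm_suminf_le[OF ultraweak_term_le[OF that] summable_mult[OF summable_add[OF s]]])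
  then show ?thesis by (rule that)
qed

text \<open>Dominated convergence for series: strong convergence handles each term and
  \<open>ultraweak_term_le\<close> supplies the majorant.\<close>

lemma ultraweak_functional_limit:
  assumes "\<omega> \<in> ultraweak_functionals" and b: "\<And>n. norm (X n) \<le> b"
    and lim: "\<And>x. (\<lambda>n. X n \<rhd> x) \<longlonglongrightarrow> L \<rhd> x"
  shows "(\<lambda>n. \<omega> (fn (X n))) \<longlonglongrightarrow> \<omega> (fn L)"
proof -
  obtain x y where \<omega>: "\<omega> = (\<lambda>A. \<Sum>n. cinner (y n) (A (x n)))"
    and s: "summable (\<lambda>n. (hnorm (x n))\<^sup>2)" "summable (\<lambda>n. (hnorm (y n))\<^sup>2)"
    using assms(1) by (auto simp: ultraweak_functionals_def)
  have pointwise: "(\<lambda>n. cinner (y k) (fn (X n) (x k))) \<longlonglongrightarrow> cinner (y k) (fn L (x k))" for k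
  proof -
    have "cinner (y k) (fn A (x k))
        = Complex (inner (Hvec (y k)) (A \<rhd> Hvec (x k))) (inner (cscale \<i> (Hvec (y k))) (A \<rhd> Hvec (x k)))" for A
      unfolding cinner_raw[symmetric] by (simp add: fn_eq_app Hvec_inverse)
    then show ?thesis
      by (simp only:) (intro tendsto_Complex tendsto_inner tendsto_const lim)
  qed
  have bound: "\<forall>\<^sub>F (k, n) in at_top \<times>\<^sub>F sequentially.
      cmod (cinner (y k) (fn (X n) (x k))) \<le> b * ((hnorm (x k))\<^sup>2 + (hnorm (y k))\<^sup>2)"
    using ultraweak_term_le[OF b] by (intro always_eventually) auto
  show ?thesis
    unfolding \<omega>
    using tannerys_theorem[OF pointwise bound summable_mult[OF summable_add[OF s]] sequentially_bot]
    by blast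
qed

text \<open>Induction over the generation of open sets; an intersection merges the functionals and
  takes the smaller radius, and the subbasic set \<open>M\<close> corresponds to no functional at
  all.\<close>

lemma openin_ultraweak_top_nbhd:
  assumes "openin (ultraweak_top M) U"
  shows "U \<subseteq> M \<and> (\<forall>A\<in>U. \<exists>\<Omega> e. finite \<Omega> \<and> \<Omega> \<subseteq> ultraweak_functionals \<and> e > 0
    \<and> {B\<in>M. \<forall>\<omega>\<in>\<Omega>. dist (\<omega> B) (\<omega> A) < e} \<subseteq> U)"
  using assms unfolding ultraweak_top_def openin_topology_generated_by_iff
proof (induction rule: generate_topology_on.induct)
  case Empty
  then show ?case by simp
next
  case (Int a b)
  show ?case
  proof (intro conjI ballI)
    show "a \<inter> b \<subseteq> M" using Int by blast
    fix A assume A: "A \<in> a \<inter> b"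
    obtain \<Omega> e where 1: "finite \<Omega>" "\<Omega> \<subseteq> ultraweak_functionals" "e > 0"
      "{B\<in>M. \<forall>\<omega>\<in>\<Omega>. dist (\<omega> B) (\<omega> A) < e} \<subseteq> a" using Int.IH(1) A by blast
    obtain \<Omega>' e' where 2: "finite \<Omega>'" "\<Omega>' \<subseteq> ultraweak_functionals" "e' > 0"
      "{B\<in>M. \<forall>\<omega>\<in>\<Omega>'. dist (\<omega> B) (\<omega> A) < e'} \<subseteq> b" using Int.IH(2) A by blast
    show "\<exists>\<Omega> e. finite \<Omega> \<and> \<Omega> \<subseteq> ultraweak_functionals \<and> e > 0
      \<and> {B\<in>M. \<forall>\<omega>\<in>\<Omega>. dist (\<omega> B) (\<omega> A) < e} \<subseteq> a \<inter> b"
      by (rule exI[of _ "\<Omega> \<union> \<Omega>'"], rule exI[of _ "min e e'"]) (use 1 2 in auto)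
  qed
next
  case (UN K)
  then show ?case by (meson Sup_least UnionE UnionI subset_iff)
next
  case (Basis S)
  then consider "S = M" | \<omega> V where "S = {A\<in>M. \<omega> A \<in> V}" "\<omega> \<in> ultraweak_functionals" "open V" by blast
  then show ?case
  proof cases
    case 1
    then show ?thesis by (auto intro!: exI[of _ "{}"] exI[of _ "1::real"])
  next
    case 2
    show ?thesis
    proof (intro conjI ballI)
      show "S \<subseteq> M" using 2 by blast
      fix A assume "A \<in> S"
      then obtain e where "e > 0" "ball (\<omega> A) e \<subseteq> V" using 2 by (auto simp: open_contains_ball)
      then show "\<exists>\<Omega> e. finite \<Omega> \<and> \<Omega> \<subseteq> ultraweak_functionals \<and> e > 0
          \<and> {B\<in>M. \<forall>\<omega>\<in>\<Omega>. dist (\<omega> B) (\<omega> A) < e} \<subseteq> S"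
        using 2 by (intro exI[of _ "{\<omega>}"] exI[of _ e]) (auto simp: subset_iff dist_commute)
    qed
  qed
qed

lemma topspace_ultraweak_top: "topspace (ultraweak_top M) = M"
proof
  show "topspace (ultraweak_top M) \<subseteq> M"
    using openin_ultraweak_top_nbhd[OF openin_topspace] by blast
  have "openin (ultraweak_top M) M"
    unfolding ultraweak_top_def openin_topology_generated_by_iff
    by (rule generate_topology_on.Basis) simp
  then show "M \<subseteq> topspace (ultraweak_top M)" by (rule openin_subset)
qed

text \<open>Commuting with an element of the commutant survives strong limits, so L lies in the
  double commutant.\<close>

lemma vN_strong_limit:
  assumes M: "von_neumann_algebra M" and X: "\<And>n::nat. fn (X n) \<in> M"
    and lim: "\<And>x. (\<lambda>n. X n \<rhd> x) \<longlonglongrightarrow> L \<rhd> x"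
  shows "fn L \<in> M"
proof -
  have "fn L \<circ> T = T \<circ> fn L" if T: "T \<in> commutant M" for T
  proof -
    define S where "S = Bop T"
    have S: "fn S = T" using T by (simp add: S_def commutant_def Bop_inverse)
    have comm: "S * X n = X n * S" for n
      using T X by (simp add: fn_inject[symmetric] times_bop.rep_eq S commutant_def)
    have "L * S = S * L"
    proof (rule bop_eqI)
      fix x
      have "(\<lambda>n. S \<rhd> X n \<rhd> x) \<longlonglongrightarrow> S \<rhd> L \<rhd> x"
        by (rule bounded_linear.tendsto[OF bounded_linear_app lim])
      moreover have "S \<rhd> X n \<rhd> x = X n \<rhd> S \<rhd> x" for n by (metis comm app_times)
      ultimately show "(L * S) \<rhd> x = (S * L) \<rhd> x" using lim[of "S \<rhd> x"] LIMSEQ_unique by auto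
    qed
    then show ?thesis by (metis S times_bop.rep_eq)
  qed
  then have "fn L \<in> commutant (commutant M)" using fn[of L] by (auto simp: commutant_def)
  then show ?thesis using M by (simp add: von_neumann_algebra_def)
qed

text \<open>One Bolzano-Weierstrass extraction per sequence yields a common convergent subsequence;
  two distinct late terms of it serve.\<close>

lemma bounded_sequences_common_close_pair:
  fixes f :: "'w \<Rightarrow> nat \<Rightarrow> complex"
  assumes "finite \<Omega>" "\<And>w. w \<in> \<Omega> \<Longrightarrow> bounded (range (f w))" "0 < e"
  shows "\<exists>m n. m \<noteq> n \<and> (\<forall>w\<in>\<Omega>. dist (f w m) (f w n) < e)"
proof -
  have "\<exists>r. strict_mono (r :: nat \<Rightarrow> nat) \<and> (\<forall>w\<in>\<Omega>. convergent (f w \<circ> r))"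
    using assms(1,2)
  proof (induction \<Omega> rule: finite_induct)
    case empty
    then show ?case by (auto intro!: exI[of _ id] simp: strict_mono_def)
  next
    case (insert w \<Omega>)
    then obtain r where r: "strict_mono (r :: nat \<Rightarrow> nat)" "\<And>w. w \<in> \<Omega> \<Longrightarrow> convergent (f w \<circ> r)"
      by (metis insertI2)
    have "bounded (range (f w \<circ> r))" using insert.prems[of w] by (auto intro: bounded_subset)
    then obtain l s where s: "strict_mono (s :: nat \<Rightarrow> nat)" "(f w \<circ> r \<circ> s) \<longlonglongrightarrow> l"
      using bounded_imp_convergent_subsequence by blast
    have "convergent (f v \<circ> (r \<circ> s))" if "v \<in> insert w \<Omega>" for v
    proof (cases "v = w")
      case True
      then show ?thesis using s(2) by (auto simp: comp_assoc convergent_def)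
    next
      case False
      then have "v \<in> \<Omega>" using that by blast
      from convergent_subseq_convergent[OF r(2)[OF this] s(1)] show ?thesis by (simp only: comp_assoc)
    qed
    then show ?case using strict_mono_o[OF r(1) s(1)] by blast
  qed
  then obtain r :: "nat \<Rightarrow> nat" where r: "strict_mono r" "\<And>w. w \<in> \<Omega> \<Longrightarrow> convergent (f w \<circ> r)" by blast
  have lim: "(\<lambda>n. f w (r n)) \<longlonglongrightarrow> lim (f w \<circ> r)" if "w \<in> \<Omega>" for w
    using r(2)[OF that] by (simp add: convergent_LIMSEQ_iff comp_def)
  have "\<forall>\<^sub>F n in sequentially. \<forall>w\<in>\<Omega>. dist (f w (r n)) (lim (f w \<circ> r)) < e / 2"
    using assms(3) by (intro eventually_ball_finite assms(1) ballI tendstoD[OF lim]) auto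
  then obtain n where n: "\<And>k. n \<le> k \<Longrightarrow> \<forall>w\<in>\<Omega>. dist (f w (r k)) (lim (f w \<circ> r)) < e / 2"
    by (auto simp: eventually_sequentially)
  have "dist (f w (r n)) (f w (r (Suc n))) < e" if "w \<in> \<Omega>" for w
    using n[of n] n[of "Suc n"] that
    by (intro dist_triangle_half_l[of "f w (r n)" "lim (f w \<circ> r)" e "f w (r (Suc n))"]) auto
  moreover have "r n \<noteq> r (Suc n)" using strict_monoD[OF r(1), of n "Suc n"] by simp
  ultimately show ?thesis by blast
qed

section \<open>The factor as a diffuse trace\<close>

locale II1_factor_trace =
  fixes M :: "'h::complex_hilbert op set" and \<tau> :: "'h op \<Rightarrow> complex"
  assumes II1: "type_II1_factor M" and trace: "faithful_normal_tracial_state M \<tau>"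
begin

lemma vN: "von_neumann_algebra M"
  using II1 by (simp add: type_II1_factor_def factor_def)

lemma in_M_bop: "A \<in> M \<Longrightarrow> \<exists>B. A = fn B"
  using vN by (metis (no_types, lifting) Bop_inverse mem_Collect_eq subset_iff von_neumann_algebra_def)

text \<open>Near L, the values of \<tau> are controlled by finitely many ultraweak functionals, and
  each of these converges along the sequence.\<close>

lemma \<tau>_strong_limit:
  assumes X: "\<And>n::nat. fn (X n) \<in> M" and b: "\<And>n. norm (X n) \<le> b"
    and lim: "\<And>x. (\<lambda>n. X n \<rhd> x) \<longlonglongrightarrow> L \<rhd> x"
  shows "(\<lambda>n. \<tau> (fn (X n))) \<longlonglongrightarrow> \<tau> (fn L)"
proof (rule tendstoI)
  fix e :: real assume "0 < e"
  have L: "fn L \<in> M" by (rule vN_strong_limit[OF vN X lim])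
  have "continuous_map (ultraweak_top M) euclidean \<tau>"
    using trace by (simp add: faithful_normal_tracial_state_def)
  then have "openin (ultraweak_top M) {A \<in> M. \<tau> A \<in> ball (\<tau> (fn L)) e}"
    unfolding continuous_map_def topspace_ultraweak_top by (metis open_openin open_ball)
  from openin_ultraweak_top_nbhd[OF this] L \<open>0 < e\<close>
  obtain \<Omega> d where \<Omega>: "finite \<Omega>" "\<Omega> \<subseteq> ultraweak_functionals" "d > 0"
    "{B\<in>M. \<forall>\<omega>\<in>\<Omega>. dist (\<omega> B) (\<omega> (fn L)) < d} \<subseteq> {A \<in> M. \<tau> A \<in> ball (\<tau> (fn L)) e}" by force
  have "\<forall>\<^sub>F n in sequentially. \<forall>\<omega>\<in>\<Omega>. dist (\<omega> (fn (X n))) (\<omega> (fn L)) < d"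
    by (intro eventually_ball_finite ballI \<Omega>(1) tendstoD[OF ultraweak_functional_limit[OF _ b lim]])
      (use \<Omega> in auto)
  then show "\<forall>\<^sub>F n in sequentially. dist (\<tau> (fn (X n))) (\<tau> (fn L)) < e"
  proof eventually_elim
    case (elim n)
    then have "\<tau> (fn (X n)) \<in> ball (\<tau> (fn L)) e" using \<Omega>(4) X by blast
    then show ?case by (simp add: dist_commute)
  qed
qed

sublocale diffuse_trace "{A. fn A \<in> M}" "\<lambda>A. \<tau> (fn A)"
proof
  note vN' = vN[unfolded von_neumann_algebra_def]
  note tr = trace[unfolded faithful_normal_tracial_state_def]
  fix A B :: "'h bop" and c :: complex
  show "1 \<in> {A. fn A \<in> M}" using vN' by (simp add: one_bop.rep_eq)
  show "A + B \<in> {A. fn A \<in> M}" if "A \<in> {A. fn A \<in> M}" "B \<in> {A. fn A \<in> M}"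
    using vN' that by (simp add: plus_bop.rep_eq)
  show "A * B \<in> {A. fn A \<in> M}" if "A \<in> {A. fn A \<in> M}" "B \<in> {A. fn A \<in> M}"
    using vN' that by (simp add: times_bop.rep_eq)
  show "bscale c A \<in> {A. fn A \<in> M}" if "A \<in> {A. fn A \<in> M}"
    using vN' that by (simp add: bscale.rep_eq)
  show "star A \<in> {A. fn A \<in> M}" if "A \<in> {A. fn A \<in> M}"
    using vN' that by (simp add: fn_star)
  show "\<tau> (fn (A + B)) = \<tau> (fn A) + \<tau> (fn B)" if "A \<in> {A. fn A \<in> M}" "B \<in> {A. fn A \<in> M}"
    using tr that by (simp add: plus_bop.rep_eq)
  show "\<tau> (fn (A * B)) = \<tau> (fn (B * A))" if "A \<in> {A. fn A \<in> M}" "B \<in> {A. fn A \<in> M}"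
    using tr that by (simp add: times_bop.rep_eq)
  show "\<tau> (fn (bscale c A)) = c * \<tau> (fn A)" if "A \<in> {A. fn A \<in> M}"
    using tr that by (simp add: bscale.rep_eq)
  show "Im (\<tau> (fn (star A * A))) = 0" "0 \<le> Re (\<tau> (fn (star A * A)))" if "A \<in> {A. fn A \<in> M}"
    using tr that by (simp_all add: times_bop.rep_eq fn_star)
  show "\<tau> (fn 1) = 1" using tr by (simp add: one_bop.rep_eq)
  show "A = 0" if "A \<in> {A. fn A \<in> M}" "\<tau> (fn (star A * A)) = 0"
    using tr that by (simp add: times_bop.rep_eq fn_star fn_inject[symmetric] zero_bop.rep_eq)
next
  fix X :: "nat \<Rightarrow> 'h bop" and L and b :: real
  assume "\<And>n. X n \<in> {A. fn A \<in> M}" and lim: "\<And>x. (\<lambda>n. X n \<rhd> x) \<longlonglongrightarrow> L \<rhd> x"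
  then have X: "fn (X n) \<in> M" for n by blast
  show "L \<in> {A. fn A \<in> M}" using vN_strong_limit[OF vN X lim] by simp
  show "(\<lambda>n. \<tau> (fn (X n))) \<longlonglongrightarrow> \<tau> (fn L)" if "\<And>n. norm (X n) \<le> b"
    by (rule \<tau>_strong_limit[OF X that lim])
next
  fix E :: "'h bop"
  assume E: "E \<in> {A. fn A \<in> M}" "E * E = E" "star E = E" "E \<noteq> 0"
  have "projection_in M (fn E)"
    using E by (simp add: projection_in_def fn_star[symmetric] times_bop.rep_eq[symmetric])
  moreover have "fn E \<noteq> op_zero" using E by (simp add: zero_bop.rep_eq[symmetric] fn_inject)
  ultimately obtain F0 where F0: "projection_in M F0" "F0 \<noteq> op_zero" "F0 \<noteq> fn E" "fn E \<circ> F0 = F0"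
    using II1 unfolding type_II1_factor_def by blast
  obtain F where F: "F0 = fn F" using in_M_bop F0(1) by (auto simp: projection_in_def)
  have "fn F \<in> M" "F * F = F" "star F = F" "F \<noteq> 0" "F \<noteq> E" "E * F = F"
    using F0 unfolding F projection_in_def fn_star[symmetric] times_bop.rep_eq[symmetric]
      zero_bop.rep_eq[symmetric] fn_inject by auto
  then show "\<exists>F\<in>{A. fn A \<in> M}. F * F = F \<and> star F = F \<and> F \<noteq> 0 \<and> F \<noteq> E \<and> E * F = F" by blast
qed

lemma one_neq_zero: "(1::'h bop) \<noteq> 0"
  using II1 by (simp add: type_II1_factor_def fn_inject[symmetric] one_bop.rep_eq zero_bop.rep_eq)

lemma projection_in_iff: "projection_in M (fn E) \<longleftrightarrow> proj E"
  by (simp add: projection_in_def proj_def fn_star[symmetric] times_bop.rep_eq[symmetric] fn_inject)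

lemma O_tau_iff: "fn A \<in> O_tau M \<tau> \<epsilon> \<delta> \<longleftrightarrow> A \<in> meas_nbhd \<epsilon> \<delta>"
proof
  assume "fn A \<in> O_tau M \<tau> \<epsilon> \<delta>"
  then obtain E0 where E0: "fn A \<in> M" "projection_in M E0" "opnorm (fn A \<circ> E0) \<le> \<epsilon>"
    "Re (\<tau> (op_diff id E0)) \<le> \<delta>" by (auto simp: O_tau_def)
  obtain E where E: "E0 = fn E" using in_M_bop E0(2) by (auto simp: projection_in_def)
  show "A \<in> meas_nbhd \<epsilon> \<delta>"
    using E0 unfolding E projection_in_iff
    by (auto simp: meas_nbhd_def norm_bop_def times_bop.rep_eq minus_bop.rep_eq one_bop.rep_eq)
next
  assume "A \<in> meas_nbhd \<epsilon> \<delta>"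
  then show "fn A \<in> O_tau M \<tau> \<epsilon> \<delta>"
    unfolding meas_nbhd_def O_tau_def projection_in_iff[symmetric]
    by (auto simp: norm_bop_def times_bop.rep_eq minus_bop.rep_eq one_bop.rep_eq)
qed

section \<open>Open sets of the measure topology\<close>

definition nb :: "'h bop \<Rightarrow> real \<Rightarrow> real \<Rightarrow> 'h bop set" where
  "nb A \<epsilon> \<delta> = {B. fn B \<in> M \<and> B - A \<in> meas_nbhd \<epsilon> \<delta>}"

lemma nb_O_tau: "{B\<in>M. op_diff B (fn A) \<in> O_tau M \<tau> \<epsilon> \<delta>} = fn ` nb A \<epsilon> \<delta>"
proof -
  have "{B\<in>M. op_diff B (fn A) \<in> O_tau M \<tau> \<epsilon> \<delta>} = fn ` {B. fn B \<in> M \<and> op_diff (fn B) (fn A) \<in> O_tau M \<tau> \<epsilon> \<delta>}"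
    using in_M_bop by blast
  then show ?thesis by (simp add: nb_def O_tau_iff[symmetric] minus_bop.rep_eq)
qed

text \<open>The generating family is already closed under unions and binary intersections, so
  generation adds no open sets.\<close>

lemma openin_measure_top:
  "openin (measure_top M \<tau>) U \<longleftrightarrow>
    U \<subseteq> M \<and> (\<forall>A. fn A \<in> U \<longrightarrow> (\<exists>\<epsilon>>0. \<exists>\<delta>>0. fn ` nb A \<epsilon> \<delta> \<subseteq> U))" (is "_ \<longleftrightarrow> ?open U")
proof -
  have family: "{U. U \<subseteq> M \<and> (\<forall>A\<in>U. \<exists>\<epsilon>>0. \<exists>\<delta>>0. {B\<in>M. op_diff B A \<in> O_tau M \<tau> \<epsilon> \<delta>} \<subseteq> U)} = {U. ?open U}"
  proof (intro Collect_cong conj_cong refl)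
    fix U assume "U \<subseteq> M"
    then have "(\<forall>A\<in>U. Q A) \<longleftrightarrow> (\<forall>A. fn A \<in> U \<longrightarrow> Q (fn A))" for Q
      using in_M_bop by (metis subset_iff)
    then show "(\<forall>A\<in>U. \<exists>\<epsilon>>0. \<exists>\<delta>>0. {B\<in>M. op_diff B A \<in> O_tau M \<tau> \<epsilon> \<delta>} \<subseteq> U)
        \<longleftrightarrow> (\<forall>A. fn A \<in> U \<longrightarrow> (\<exists>\<epsilon>>0. \<exists>\<delta>>0. fn ` nb A \<epsilon> \<delta> \<subseteq> U))"
      by (simp only: nb_O_tau)
  qed
  have "?open U" if "generate_topology_on {U. ?open U} U"
    using that
  proof (induction rule: generate_topology_on.induct)
    case Empty
    then show ?case by simp
  next
    case (Int a b)
    show ?case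
    proof (intro conjI allI impI)
      show "a \<inter> b \<subseteq> M" using Int by blast
      fix A assume A: "fn A \<in> a \<inter> b"
      obtain \<epsilon> \<delta> where 1: "\<epsilon> > 0" "\<delta> > 0" "fn ` nb A \<epsilon> \<delta> \<subseteq> a" using Int.IH(1) A by blast
      obtain \<epsilon>' \<delta>' where 2: "\<epsilon>' > 0" "\<delta>' > 0" "fn ` nb A \<epsilon>' \<delta>' \<subseteq> b" using Int.IH(2) A by blast
      have "nb A (min \<epsilon> \<epsilon>') (min \<delta> \<delta>') \<subseteq> nb A \<epsilon> \<delta>" "nb A (min \<epsilon> \<epsilon>') (min \<delta> \<delta>') \<subseteq> nb A \<epsilon>' \<delta>'"
        using meas_nbhd_mono[of "min \<epsilon> \<epsilon>'" \<epsilon> "min \<delta> \<delta>'" \<delta>]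
          meas_nbhd_mono[of "min \<epsilon> \<epsilon>'" \<epsilon>' "min \<delta> \<delta>'" \<delta>'] by (auto simp: nb_def)
      then have "fn ` nb A (min \<epsilon> \<epsilon>') (min \<delta> \<delta>') \<subseteq> a \<inter> b" using 1(3) 2(3) by blast
      moreover have "min \<epsilon> \<epsilon>' > 0" "min \<delta> \<delta>' > 0" using 1 2 by simp_all
      ultimately show "\<exists>\<epsilon>>0. \<exists>\<delta>>0. fn ` nb A \<epsilon> \<delta> \<subseteq> a \<inter> b" by blast
    qed
  next
    case (UN K)
    show ?case
    proof (intro conjI allI impI)
      show "\<Union>K \<subseteq> M" using UN by blast
      fix A assume "fn A \<in> \<Union>K"
      then obtain k where k: "k \<in> K" "fn A \<in> k" by blast
      then obtain \<epsilon> \<delta> where "\<epsilon> > 0" "\<delta> > 0" "fn ` nb A \<epsilon> \<delta> \<subseteq> k" using UN by blast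
      then show "\<exists>\<epsilon>>0. \<exists>\<delta>>0. fn ` nb A \<epsilon> \<delta> \<subseteq> \<Union>K" using k by blast
    qed
  qed blast
  then show ?thesis
    unfolding measure_top_def openin_topology_generated_by_iff family
    using generate_topology_on.Basis[of U "{U. ?open U}"] by (intro iffI) simp_all
qed

lemma topspace_measure_top: "topspace (measure_top M \<tau>) = M"
proof
  show "topspace (measure_top M \<tau>) \<subseteq> M" using openin_topspace openin_measure_top by blast
  have "openin (measure_top M \<tau>) M"
    unfolding openin_measure_top by (auto simp: nb_def intro!: exI[of _ "1::real"])
  then show "M \<subseteq> topspace (measure_top M \<tau>)" by (rule openin_subset)
qed

lemma nb_self: "fn A \<in> M \<Longrightarrow> 0 < \<epsilon> \<Longrightarrow> 0 < \<delta> \<Longrightarrow> A \<in> nb A \<epsilon> \<delta>"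
  using meas_nbhd_of_norm[of 0 \<epsilon> \<delta>] zero_mem by (simp add: nb_def)

lemma nb_triangle: "B \<in> nb A \<epsilon> \<delta> \<Longrightarrow> C \<in> nb B \<epsilon>' \<delta>' \<Longrightarrow> C \<in> nb A (\<epsilon> + \<epsilon>') (\<delta> + \<delta>')"
  using meas_nbhd_add[of "B - A" \<epsilon> \<delta> "C - B" \<epsilon>' \<delta>'] by (simp add: nb_def)

text \<open>V is the interior of \<open>nb A \<epsilon> \<delta>\<close>. Its openness comes from
  \<open>nb_triangle\<close>: halving both parameters leaves room around every nearby point.\<close>

lemma nb_contains_open:
  assumes "fn A \<in> M" "0 < \<epsilon>" "0 < \<delta>"
  obtains V where "openin (measure_top M \<tau>) V" "fn A \<in> V" "V \<subseteq> fn ` nb A \<epsilon> \<delta>"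
proof
  define V where "V = {B. fn B \<in> M \<and> (\<exists>\<epsilon>'>0. \<exists>\<delta>'>0. nb B \<epsilon>' \<delta>' \<subseteq> nb A \<epsilon> \<delta>)}"
  show "fn ` V \<subseteq> fn ` nb A \<epsilon> \<delta>" using nb_self by (force simp: V_def)
  show "fn A \<in> fn ` V" using assms by (auto simp: V_def)
  show "openin (measure_top M \<tau>) (fn ` V)"
    unfolding openin_measure_top
  proof (intro conjI allI impI)
    show "fn ` V \<subseteq> M" by (auto simp: V_def)
    fix B assume "fn B \<in> fn ` V"
    then obtain \<epsilon>' \<delta>' where pos: "\<epsilon>' > 0" "\<delta>' > 0" and sub: "nb B \<epsilon>' \<delta>' \<subseteq> nb A \<epsilon> \<delta>"
      by (auto simp: V_def fn_inject)
    have "nb B (\<epsilon>' / 2) (\<delta>' / 2) \<subseteq> V"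
    proof
      fix C assume C: "C \<in> nb B (\<epsilon>' / 2) (\<delta>' / 2)"
      have "nb C (\<epsilon>' / 2) (\<delta>' / 2) \<subseteq> nb B \<epsilon>' \<delta>'" using nb_triangle[OF C] by fastforce
      then have "\<exists>\<epsilon>'>0. \<exists>\<delta>'>0. nb C \<epsilon>' \<delta>' \<subseteq> nb A \<epsilon> \<delta>"
        using sub pos by (intro exI[of _ "\<epsilon>' / 2"] conjI exI[of _ "\<delta>' / 2"]) auto
      then show "C \<in> V" using C by (simp add: V_def nb_def[of B])
    qed
    then show "\<exists>\<epsilon>>0. \<exists>\<delta>>0. fn ` nb B \<epsilon> \<delta> \<subseteq> fn ` V"
      using pos by (intro exI[of _ "\<epsilon>' / 2"] conjI exI[of _ "\<delta>' / 2"]) auto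
  qed
qed

section \<open>The statements of the theorem\<close>

lemma measure_coarser_norm:
  assumes "openin (measure_top M \<tau>) U" shows "openin (norm_top M) U"
proof -
  have "\<exists>r>0. {B\<in>M. opnorm (op_diff B A) < r} \<subseteq> U" if "A \<in> U" for A
  proof -
    obtain A' where A': "A = fn A'" using \<open>A \<in> U\<close> assms in_M_bop unfolding openin_measure_top by blast
    then obtain \<epsilon> \<delta> where pos: "\<epsilon> > 0" "\<delta> > 0" and sub: "fn ` nb A' \<epsilon> \<delta> \<subseteq> U"
      using assms \<open>A \<in> U\<close> unfolding openin_measure_top by blast
    have "B \<in> U" if B: "B \<in> M" "opnorm (op_diff B A) < \<epsilon>" for B
    proof -
      obtain B' where B': "B = fn B'" using in_M_bop B by blast
      have "fn A' \<in> M" using \<open>A \<in> U\<close> A' assms by (auto simp: openin_measure_top)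
      then have "B' - A' \<in> meas_nbhd \<epsilon> \<delta>"
        using B pos diff_mem[of B' A'] unfolding A' B'
        by (intro meas_nbhd_of_norm) (auto simp: norm_bop_def minus_bop.rep_eq)
      then have "B' \<in> nb A' \<epsilon> \<delta>" using B B' by (simp add: nb_def)
      then show ?thesis using sub B' by blast
    qed
    then show ?thesis using pos by blast
  qed
  moreover have "U \<subseteq> M" using assms by (simp add: openin_measure_top)
  ultimately show ?thesis
    unfolding norm_top_def openin_topology_generated_by_iff
    by (intro generate_topology_on.Basis) blast
qed

lemma not_measure_coarser_ultraweak:
  "\<not> (\<forall>U. openin (measure_top M \<tau>) U \<longrightarrow> openin (ultraweak_top M) U)"
proof
  assume coarser: "\<forall>U. openin (measure_top M \<tau>) U \<longrightarrow> openin (ultraweak_top M) U"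
  obtain \<epsilon> \<delta> where pos: "0 < \<epsilon>" "0 < \<delta>"
    and sep: "\<And>m n. m \<noteq> n \<Longrightarrow> rademacher m 1 - rademacher n 1 \<notin> meas_nbhd \<epsilon> \<delta>"
    using rademacher_separated by blast
  obtain V where V: "openin (measure_top M \<tau>) V" "fn 0 \<in> V" "V \<subseteq> fn ` nb 0 \<epsilon> \<delta>"
    using nb_contains_open[of 0 \<epsilon> \<delta>] zero_mem pos by auto
  obtain \<Omega> e where \<Omega>: "finite \<Omega>" "\<Omega> \<subseteq> ultraweak_functionals" "e > 0"
    "{B\<in>M. \<forall>\<omega>\<in>\<Omega>. dist (\<omega> B) (\<omega> (fn 0)) < e} \<subseteq> V"
    using bspec[OF conjunct2[OF openin_ultraweak_top_nbhd[OF coarser[rule_format, OF V(1)]]] V(2)] by blast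
  have "bounded (range (\<lambda>n. \<omega> (fn (rademacher n 1))))" if "\<omega> \<in> \<Omega>" for \<omega>
  proof -
    obtain c where c: "\<And>A. norm A \<le> 1 \<Longrightarrow> cmod (\<omega> (fn A)) \<le> c"
      using ultraweak_functional_le[OF subsetD[OF \<Omega>(2) \<open>\<omega> \<in> \<Omega>\<close>]] by blast
    show ?thesis by (rule boundedI[of _ c]) (use c[OF norm_rademacher] in blast)
  qed
  then obtain m n where mn: "m \<noteq> n"
    "\<And>\<omega>. \<omega> \<in> \<Omega> \<Longrightarrow> dist (\<omega> (fn (rademacher m 1))) (\<omega> (fn (rademacher n 1))) < e"
    using bounded_sequences_common_close_pair[OF \<Omega>(1) _ \<Omega>(3), of "\<lambda>\<omega> n. \<omega> (fn (rademacher n 1))"] by blast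
  define X where "X = rademacher m 1 - rademacher n 1"
  have "fn X \<in> M" using rademacher[OF proj_one] diff_mem unfolding X_def by blast
  moreover have "dist (\<omega> (fn X)) (\<omega> (fn 0)) < e" if "\<omega> \<in> \<Omega>" for \<omega>
  proof -
    have \<omega>: "\<omega> \<in> ultraweak_functionals" using that \<Omega>(2) by blast
    have "\<omega> (fn 0) = 0" using ultraweak_functional_diff[OF \<omega>, of 0 0] by simp
    then show ?thesis
      using mn(2)[OF that] ultraweak_functional_diff[OF \<omega>] by (simp add: X_def dist_norm)
  qed
  ultimately have "fn X \<in> V" using \<Omega>(4) by blast
  then have "X \<in> nb 0 \<epsilon> \<delta>" using V(3) by (auto simp: fn_inject)
  then show False using sep[OF mn(1)] by (simp add: nb_def X_def)
qed

lemma trace_not_measure_continuous: "\<not> continuous_map (measure_top M \<tau>) euclidean \<tau>"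
proof
  assume "continuous_map (measure_top M \<tau>) euclidean \<tau>"
  then have U: "openin (measure_top M \<tau>) {A \<in> M. \<tau> A \<in> ball 0 1}"
    unfolding continuous_map_def topspace_measure_top by (metis open_openin open_ball)
  have zero: "fn 0 \<in> {A \<in> M. \<tau> A \<in> ball 0 1}" using zero_mem t_zero by simp
  obtain \<epsilon> \<delta> where pos: "\<epsilon> > 0" "\<delta> > 0" and sub: "fn ` nb 0 \<epsilon> \<delta> \<subseteq> {A \<in> M. \<tau> A \<in> ball 0 1}"
    using mp[OF spec[OF conjunct2[OF iffD1[OF openin_measure_top U]]] zero] by blast
  obtain P where P: "proj P" "P \<noteq> 0" "Re (\<tau> (fn P)) \<le> \<delta>"
    using exists_small_subproj[OF proj_one one_neq_zero pos(2)] by blast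
  have tP: "0 < Re (\<tau> (fn P))" by (rule t_proj_pos[OF P(1,2)])
  \<comment> \<open>A vanishes on the range of \<open>1 - P\<close>, whose complement has trace at
    most \<delta>. It thus lies in the neighbourhood whatever its norm and whatever
    \<epsilon>.\<close>
  define A where "A = (1 / Re (\<tau> (fn P))) *\<^sub>R P"
  have A: "fn A \<in> M" using projD(1)[OF P(1)] scaleR_mem[of P] by (simp add: A_def)
  have "A * (1 - P) = 0" by (simp add: A_def right_diff_distrib projD[OF P(1)])
  then have "A \<in> meas_nbhd \<epsilon> \<delta>"
    using A P pos proj_compl[OF P(1)] by (auto simp: meas_nbhd_def intro!: exI[of _ "1 - P"])
  then have "\<tau> (fn A) \<in> ball 0 1" using sub A by (auto simp: nb_def)
  moreover have "\<tau> (fn A) = 1"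
    using t_scaleR[OF projD(1)[OF P(1)], of "1 / Re (\<tau> (fn P))"] t_proj_real[OF P(1)] tP
    by (simp add: A_def complex_eq_iff)
  ultimately show False by simp
qed

text \<open>Normality makes \<tau> ultraweakly continuous, and a finer topology would inherit that
  continuity.\<close>

lemma not_ultraweak_coarser_measure:
  "\<not> (\<forall>U. openin (ultraweak_top M) U \<longrightarrow> openin (measure_top M \<tau>) U)"
proof
  assume finer: "\<forall>U. openin (ultraweak_top M) U \<longrightarrow> openin (measure_top M \<tau>) U"
  have "continuous_map (ultraweak_top M) euclidean \<tau>"
    using trace by (simp add: faithful_normal_tracial_state_def)
  then have "continuous_map (measure_top M \<tau>) euclidean \<tau>"
    using finer by (simp add: continuous_map_def topspace_measure_top topspace_ultraweak_top)
  then show False using trace_not_measure_continuous by blast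
qed

lemma unit_ball_iff: "fn A \<in> unit_ball M \<longleftrightarrow> fn A \<in> M \<and> norm A \<le> 1"
  by (simp add: unit_ball_def norm_bop_def)

lemma trace_measure_continuous_unit_ball:
  "continuous_map (subtopology (measure_top M \<tau>) (unit_ball M)) euclidean \<tau>"
  unfolding continuous_map_def
proof (intro conjI allI impI)
  fix U :: "complex set" assume "openin euclidean U"
  have ball: "unit_ball M \<subseteq> M" by (auto simp: unit_ball_def)
  then have top: "topspace (subtopology (measure_top M \<tau>) (unit_ball M)) = unit_ball M"
    by (auto simp: topspace_measure_top)
  show "openin (subtopology (measure_top M \<tau>) (unit_ball M))
      {x \<in> topspace (subtopology (measure_top M \<tau>) (unit_ball M)). \<tau> x \<in> U}"
    unfolding top
  proof (subst openin_subopen, intro ballI)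
    fix x assume x: "x \<in> {x \<in> unit_ball M. \<tau> x \<in> U}"
    then obtain A where A: "x = fn A" using in_M_bop ball by blast
    then obtain e where e: "e > 0" "ball (\<tau> (fn A)) e \<subseteq> U"
      using x \<open>openin euclidean U\<close> by (metis (no_types, lifting) mem_Collect_eq open_contains_ball open_openin)
    \<comment> \<open>Two points of the unit ball differ by norm at most 2, whence the factor 4 in
      sqrt \<delta> (4 K + 1). Each of the two terms is kept below e/2; the denominators use K + 1
      and 4 K + 2 to make these bounds strict.\<close>
    define \<epsilon> where "\<epsilon> = e / (2 * (K + 1))"
    define \<delta> where "\<delta> = (e / (2 * (4 * K + 2)))\<^sup>2"
    have pos: "0 < \<epsilon>" "0 < \<delta>" using e K_nonneg by (simp_all add: \<epsilon>_def \<delta>_def)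
    have "K * \<epsilon> < e / 2" using e K_nonneg by (simp add: \<epsilon>_def field_simps)
    moreover have "sqrt \<delta> * (K * 4 + 1) < e / 2"
    proof -
      have "sqrt \<delta> = e / (2 * (4 * K + 2))"
        unfolding \<delta>_def real_sqrt_abs using e K_nonneg by simp
      then have "sqrt \<delta> * (K * 4 + 1) = e / 2 - sqrt \<delta>"
        using K_nonneg by (simp add: field_simps)
      then show ?thesis using pos(2) by simp
    qed
    ultimately have small: "K * \<epsilon> + sqrt \<delta> * (K * 4 + 1) < e" by linarith
    obtain V where V: "openin (measure_top M \<tau>) V" "fn A \<in> V" "V \<subseteq> fn ` nb A \<epsilon> \<delta>"
      using nb_contains_open[of A \<epsilon> \<delta>] x A ball pos by blast
    have "\<tau> y \<in> U" if "y \<in> V" "y \<in> unit_ball M" for y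
    proof -
      obtain B where B: "y = fn B" "B \<in> nb A \<epsilon> \<delta>" using V(3) \<open>y \<in> V\<close> by blast
      have norms: "norm A \<le> 1" "norm B \<le> 1" "fn A \<in> M" "fn B \<in> M"
        using x A that B unit_ball_iff by auto
      then have "norm (B - A) \<le> 2" using norm_triangle_ineq4[of B A] by linarith
      then have sq: "(norm (B - A))\<^sup>2 \<le> 4" using power_mono[of "norm (B - A)" 2 2] by simp
      have "cmod (\<tau> (fn (B - A))) \<le> K * \<epsilon> + sqrt \<delta> * (K * (norm (B - A))\<^sup>2 + 1)"
        by (rule t_meas_nbhd_le) (use B pos in \<open>auto simp: nb_def\<close>)
      also have "\<dots> \<le> K * \<epsilon> + sqrt \<delta> * (K * 4 + 1)"
        using sq K_nonneg pos by (intro add_left_mono mult_left_mono add_right_mono) auto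
      finally have "dist (\<tau> (fn B)) (\<tau> (fn A)) < e"
        using small t_diff[of B A] norms by (simp add: dist_norm)
      then show ?thesis using e(2) B(1) by (auto simp: dist_commute)
    qed
    then show "\<exists>T. openin (subtopology (measure_top M \<tau>) (unit_ball M)) T \<and> x \<in> T
        \<and> T \<subseteq> {x \<in> unit_ball M. \<tau> x \<in> U}"
      using V x A by (intro exI[of _ "V \<inter> unit_ball M"]) (auto simp: openin_subtopology)
  qed
qed simp

text \<open>Pigeonhole: a finite cover by sets of half the separation size would put two distinct
  Rademacher unitaries into the same set.\<close>

lemma unit_ball_not_measure_compact: "\<not> compactin (measure_top M \<tau>) (unit_ball M)"
proof
  assume compact: "compactin (measure_top M \<tau>) (unit_ball M)"
  obtain \<epsilon> \<delta> where pos: "0 < \<epsilon>" "0 < \<delta>"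
    and sep: "\<And>m n. m \<noteq> n \<Longrightarrow> rademacher m 1 - rademacher n 1 \<notin> meas_nbhd \<epsilon> \<delta>"
    using rademacher_separated by blast
  define \<V> where "\<V> = {V. openin (measure_top M \<tau>) V \<and> (\<exists>A. V \<subseteq> fn ` nb A (\<epsilon> / 2) (\<delta> / 2))}"
  have "unit_ball M \<subseteq> \<Union>\<V>"
  proof
    fix x assume x: "x \<in> unit_ball M"
    then obtain A where A: "x = fn A" "fn A \<in> M" using in_M_bop by (auto simp: unit_ball_def)
    then obtain V where "openin (measure_top M \<tau>) V" "fn A \<in> V" "V \<subseteq> fn ` nb A (\<epsilon> / 2) (\<delta> / 2)"
      using nb_contains_open[of A "\<epsilon> / 2" "\<delta> / 2"] pos by auto
    then show "x \<in> \<Union>\<V>" using A(1) unfolding \<V>_def by blast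
  qed
  then obtain \<F> where \<F>: "finite \<F>" "\<F> \<subseteq> \<V>" "unit_ball M \<subseteq> \<Union>\<F>"
    using compact unfolding compactin_def \<V>_def by (metis (no_types, lifting) mem_Collect_eq)
  have U: "fn (rademacher n 1) \<in> unit_ball M" for n
    using rademacher[OF proj_one, of n] norm_rademacher[of n] by (simp add: unit_ball_iff)
  then have "\<exists>V\<in>\<F>. fn (rademacher n 1) \<in> V" for n using \<F>(3) by blast
  then obtain V where V: "\<And>n. V n \<in> \<F>" "\<And>n. fn (rademacher n 1) \<in> V n" by metis
  have "finite (range V)" using V(1) \<F>(1) finite_subset[of "range V" \<F>] by blast
  then have "\<not> inj V" using finite_imageD[of V UNIV] by auto
  then obtain m n where mn: "m \<noteq> n" "V m = V n" by (auto simp: inj_def)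
  have "V m \<in> \<V>" using V(1) \<F>(2) by blast
  then obtain A where "V m \<subseteq> fn ` nb A (\<epsilon> / 2) (\<delta> / 2)" unfolding \<V>_def by blast
  then have "rademacher m 1 \<in> nb A (\<epsilon> / 2) (\<delta> / 2)" "rademacher n 1 \<in> nb A (\<epsilon> / 2) (\<delta> / 2)"
    using V(2)[of m] V(2)[of n] mn(2) by (auto simp: fn_inject)
  then have "(rademacher m 1 - A) - (rademacher n 1 - A) \<in> meas_nbhd (\<epsilon> / 2 + \<epsilon> / 2) (\<delta> / 2 + \<delta> / 2)"
    by (intro meas_nbhd_diff) (auto simp: nb_def)
  then show False using sep[OF mn(1)] by simp
qed

text \<open>Indices are chosen increasing in the directed order, each inside the Cauchy tail of its
  level. The resulting sequence has a limit, and the Cauchy tails carry the whole net to it.\<close>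

lemma unit_ball_measure_complete:
  fixes D :: "'i set" and f :: "'i \<Rightarrow> 'h op"
  assumes D: "directed_set D le" and f: "\<And>i. i \<in> D \<Longrightarrow> f i \<in> unit_ball M"
    and cauchy: "measure_cauchy_net M \<tau> D le f"
  shows "\<exists>L\<in>unit_ball M. net_converges_in (measure_top M \<tau>) D le f L"
proof -
  define c :: "nat \<Rightarrow> real" where "c n = (1 / 2) ^ n" for n
  define tail where "tail n i \<longleftrightarrow> i \<in> D \<and> (\<forall>j\<in>D. \<forall>k\<in>D. le i j \<and> le i k
    \<longrightarrow> op_diff (f j) (f k) \<in> O_tau M \<tau> (c n) (c n))" for n i
  have ex_tail: "\<exists>i. tail n i" for n
    using cauchy unfolding measure_cauchy_net_def tail_def
    by (metis c_def half_gt_zero zero_less_one zero_less_power)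
  \<comment> \<open>The next index must also follow the current one, so that consecutive terms of
    the sequence are within the current tolerance, as \<open>measure_complete_sequence\<close>
    demands.\<close>
  have "\<exists>j. tail (Suc n) j \<and> le i j" if "tail n i" for n i
  proof -
    obtain i' where i': "tail (Suc n) i'" using ex_tail by blast
    have "i \<in> D" "i' \<in> D" using that i' by (auto simp: tail_def)
    then obtain j where j: "j \<in> D" "le i j" "le i' j" using D unfolding directed_set_def by blast
    have "le i' k" if "k \<in> D" "le j k" for k
      using D that j \<open>i' \<in> D\<close> unfolding directed_set_def by blast
    then have "tail (Suc n) j" using i' j(1) by (auto simp: tail_def)
    then show ?thesis using j by blast
  qed
  then obtain g where g: "\<And>n. tail n (g n)" "\<And>n. le (g n) (g (Suc n))"
    using dependent_nat_choice[of tail "\<lambda>_. le"] ex_tail by metis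
  have gD: "g n \<in> D" for n using g(1) by (simp add: tail_def)
  have refl: "le i i" if "i \<in> D" for i using D that by (auto simp: directed_set_def)
  have "\<exists>B. f i = fn B \<and> fn B \<in> M \<and> norm B \<le> 1" if "i \<in> D" for i
  proof -
    have "f i \<in> M" using f[OF that] by (simp add: unit_ball_def)
    then obtain B where "f i = fn B" using in_M_bop by blast
    then show ?thesis using f[OF that] unit_ball_iff[of B] by auto
  qed
  then obtain h where h: "\<And>i. i \<in> D \<Longrightarrow> f i = fn (h i) \<and> fn (h i) \<in> M \<and> norm (h i) \<le> 1" by metis
  have close: "h i - h j \<in> meas_nbhd (c n) (c n)" if "i \<in> D" "j \<in> D" "le (g n) i" "le (g n) j" for i j n
  proof -
    have "op_diff (f i) (f j) \<in> O_tau M \<tau> (c n) (c n)" using g(1)[of n] that by (simp add: tail_def)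
    then show ?thesis using h that by (simp add: minus_bop.rep_eq[symmetric] O_tau_iff)
  qed
  obtain L where L: "fn L \<in> M" "norm L \<le> 1" "\<And>n. h (g n) - L \<in> meas_nbhd (2 * c n) (2 * c n)"
    using measure_complete_sequence[of "\<lambda>n. h (g n)"] h gD close[OF gD gD g(2) refl[OF gD]]
    unfolding c_def by auto
  have "net_converges_in (measure_top M \<tau>) D le f (fn L)"
    unfolding net_converges_in_def topspace_measure_top
  proof (intro conjI allI impI)
    show "fn L \<in> M" by fact
    fix U assume U: "openin (measure_top M \<tau>) U \<and> fn L \<in> U"
    then obtain \<epsilon> \<delta> where pos: "\<epsilon> > 0" "\<delta> > 0" and sub: "fn ` nb L \<epsilon> \<delta> \<subseteq> U"
      by (auto simp: openin_measure_top)
    \<comment> \<open>The factor 3 is one share \<open>c n\<close> for the tail of the net and two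
      for the distance of the sequence to L.\<close>
    obtain n where n: "c n < min \<epsilon> \<delta> / 3"
      using real_arch_pow_inv[of "min \<epsilon> \<delta> / 3" "1 / 2"] pos by (auto simp: c_def)
    have "f i \<in> U" if i: "i \<in> D" "le (g n) i" for i
    proof -
      have "(h i - h (g n)) + (h (g n) - L) \<in> meas_nbhd (c n + 2 * c n) (c n + 2 * c n)"
        by (intro meas_nbhd_add close L(3) i gD refl)
      then have "h i - L \<in> meas_nbhd \<epsilon> \<delta>"
        using n meas_nbhd_mono[of "c n + 2 * c n" \<epsilon> "c n + 2 * c n" \<delta>] by auto
      then have "h i \<in> nb L \<epsilon> \<delta>" using h i by (simp add: nb_def)
      then show ?thesis using sub h[OF i(1)] by auto
    qed
    then show "\<exists>i0\<in>D. \<forall>i\<in>D. le i0 i \<longrightarrow> f i \<in> U" using gD by blast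
  qed
  then show ?thesis using L unit_ball_iff by blast
qed

end

theorem theorem3p17:
  fixes M :: "('h::complex_hilbert) op set"
    and \<tau> :: "'h op \<Rightarrow> complex"
  assumes "type_II1_factor M"
    and "faithful_normal_tracial_state M \<tau>"
  shows "(\<forall>U. openin (measure_top M \<tau>) U \<longrightarrow> openin (norm_top M) U)
    \<and> \<not> (\<forall>U. openin (measure_top M \<tau>) U \<longrightarrow> openin (ultraweak_top M) U)
    \<and> \<not> (\<forall>U. openin (ultraweak_top M) U \<longrightarrow> openin (measure_top M \<tau>) U)
    \<and> \<not> continuous_map (measure_top M \<tau>) euclidean \<tau>
    \<and> continuous_map (subtopology (measure_top M \<tau>) (unit_ball M)) euclidean \<tau>
    \<and> \<not> compactin (measure_top M \<tau>) (unit_ball M)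
    \<and> (\<forall>(D :: 'i set) le (f :: 'i \<Rightarrow> 'h op).
         directed_set D le \<and> (\<forall>i\<in>D. f i \<in> unit_ball M) \<and> measure_cauchy_net M \<tau> D le f
         \<longrightarrow> (\<exists>L\<in>unit_ball M. net_converges_in (measure_top M \<tau>) D le f L))"
proof -
  interpret II1_factor_trace M \<tau> by unfold_locales fact+
  show ?thesis
    using measure_coarser_norm not_measure_coarser_ultraweak not_ultraweak_coarser_measure
      trace_not_measure_continuous trace_measure_continuous_unit_ball unit_ball_not_measure_compact
      unit_ball_measure_complete by blast
qed

end
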